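(* Let $H$ be a separable infinite-dimensional Hilbert space and let $\alpha$ be a non-principal ultrafilter on $\mathbb{N}$. If $\alpha$ has the $3$f-property, then $\mathscr{F}_\alpha(B(H))$ is trivial, i.e. $\mathscr{F}_\alpha(B(H))=\mathbb{C}$.
   Context: $B(H)$ is the algebra of bounded linear operators on the (complex) Hilbert space $H$. Ultrapower and commutant: for a unital $C^*$-algebra $A$ and a non-principal ultrafilter $\alpha$ on $\mathbb{N}$, let $\mathscr{A}_\infty=\{(x_n)\in\prod_n A:\sup_n\|x_n\|<\infty\}$ and $\mathscr{N}_\alpha=\{(x_n)\in\mathscr{A}_\infty:\lim_{n\to\alpha}\|x_n\|=0\}$. The ultrapower is the $C^*$-algebra $\mathscr{C}_\alpha(A)=\mathscr{A}_\infty/\mathscr{N}_\alpha$. $A$ is identified with the subalgebra of classes of constant sequences, and $\mathscr{F}_\alpha(A)=\{\mathbf b\in\mathscr{C}_\alpha(A):\mathbf b\mathbf a=\mathbf a\mathbf b\ \text{for all }\mathbf a\in A\}$. It is called trivial if it equals $\mathbb{C}$ (scalar multiples of the unit). $3$f-property: the non-principal ultrafilter $\alpha$ on $\mathbb{N}$ has the three functions property ($3$f-property) if there exists a bijection $\phi:\mathbb{N}\to\mathbb{N}^2$ such that for every $f:\mathbb{N}\to\mathbb{N}$ there exists $A\in\alpha$ satisfying one of: (i) $f|_A$ is constant; (ii) $f|_A$ is finite-to-one; (iii) there is a one-to-one function $\bar f:\mathbb{N}\to\mathbb{N}$ such that $f|_A=\bar f\circ\pi\circ\phi|_A$, where $\pi:\mathbb{N}^2\to\mathbb{N}$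 is the projection onto the first coordinate. *)

theory Defs
  imports "HOL-Analysis.Analysis" "HOL-Algebra.QuotRing"
begin

section \<open>Complex Hilbert spaces\<close>

class complex_normed_vector = real_normed_vector +
  fixes scaleC :: "complex \<Rightarrow> 'a \<Rightarrow> 'a"  (infixr \<open>*\<^sub>C\<close> 75)
  assumes scaleC_add_right: "c *\<^sub>C (x + y) = c *\<^sub>C x + c *\<^sub>C y"
    and scaleC_add_left: "(c + d) *\<^sub>C x = c *\<^sub>C x + d *\<^sub>C x"
    and scaleC_scaleC: "c *\<^sub>C d *\<^sub>C x = (c * d) *\<^sub>C x"
    and scaleC_of_real: "complex_of_real r *\<^sub>C x = r *\<^sub>R x"
    and norm_scaleC: "norm (c *\<^sub>C x) = cmod c * norm x"

lemma vector_space_scaleC: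
  "vector_space (scaleC :: complex \<Rightarrow> 'a \<Rightarrow> 'a::complex_normed_vector)"
proof
  show "1 *\<^sub>C x = x" for x :: 'a
    using scaleC_of_real[of 1 x] by simp
qed (simp_all add: scaleC_add_right scaleC_add_left scaleC_scaleC)

class complex_inner = complex_normed_vector +
  fixes cinner :: "'a \<Rightarrow> 'a \<Rightarrow> complex"
  assumes cinner_commute: "cinner x y = cnj (cinner y x)"
    and cinner_add_left: "cinner (x + y) z = cinner x z + cinner y z"
    and cinner_scaleC_left: "cinner (c *\<^sub>C x) y = c * cinner x y"
    and cinner_self: "cinner x x = complex_of_real ((norm x)\<^sup>2)"

class complex_hilbert = complex_inner + complete_space

definition infinite_dimensional :: "'h::complex_normed_vector itself \<Rightarrow> bool"
  where "infinite_dimensional _ \<longleftrightarrow>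
    \<not> (\<exists>B::'h set. finite B \<and> module.span scaleC B = UNIV)"

section \<open>Bounded operators\<close>

text \<open>Unital normed algebras over the complex numbers. The axiom \<open>norm 1 = 1\<close> (and with it
  \<open>0 \<noteq> 1\<close>) is left out so that the operators on the zero space form an instance.\<close>

class complex_unital_normed_algebra =
  complex_normed_vector + real_normed_algebra + monoid_mult +
  assumes scaleC_mult_left: "(c *\<^sub>C a) * b = c *\<^sub>C (a * b)"
    and scaleC_mult_right: "a * (c *\<^sub>C b) = c *\<^sub>C (a * b)"

text \<open>The library type \<open>'h \<Rightarrow>\<^sub>L 'h\<close> consists of the real-linear bounded operators; \<open>'h bop\<close> is the
  subalgebra \<open>B(H)\<close> of the complex-linear ones, with composition as multiplication and the
  operator norm.\<close>

typedef (overloaded) 'h bop =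
  "{T :: 'h::complex_normed_vector \<Rightarrow>\<^sub>L 'h.
      \<forall>c x. blinfun_apply T (c *\<^sub>C x) = c *\<^sub>C blinfun_apply T x}"
  morphisms blinfun_of_bop Abs_bop
proof -
  interpret vector_space "scaleC :: complex \<Rightarrow> 'h \<Rightarrow> 'h"
    by (rule vector_space_scaleC)
  show ?thesis
    by (rule exI[of _ 0]) simp
qed

setup_lifting type_definition_bop

lift_definition bop_apply :: "'h::complex_normed_vector bop \<Rightarrow> 'h \<Rightarrow> 'h"
  is blinfun_apply .

lemma bounded_linear_scaleC:
  "bounded_linear (\<lambda>x::'h::complex_normed_vector. c *\<^sub>C x)"
proof
  show "c *\<^sub>C (r *\<^sub>R x) = r *\<^sub>R (c *\<^sub>C x)" for r and x :: 'h
    by (simp add: scaleC_scaleC mult.commute flip: scaleC_of_real)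
  show "\<exists>K. \<forall>x::'h. norm (c *\<^sub>C x) \<le> norm x * K"
    by (auto intro!: exI[of _ "cmod c"] simp: norm_scaleC)
qed (simp add: scaleC_add_right)

lift_definition scaleC_blinfun :: "complex \<Rightarrow> 'h::complex_normed_vector \<Rightarrow>\<^sub>L 'h \<Rightarrow> 'h \<Rightarrow>\<^sub>L 'h"
  is "\<lambda>c f x. c *\<^sub>C f x"
  by (rule bounded_linear_compose[OF bounded_linear_scaleC])

lemma norm_scaleC_blinfun: "norm (scaleC_blinfun c T) = cmod c * norm T"
proof -
  have le: "norm (scaleC_blinfun c T) \<le> cmod c * norm T"
    for c and T :: "'h::complex_normed_vector \<Rightarrow>\<^sub>L 'h"
    by (intro norm_blinfun_bound)
      (auto simp: scaleC_blinfun.rep_eq norm_scaleC mult.assoc intro!: mult_left_mono norm_blinfun)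
  show ?thesis
  proof (cases "c = 0")
    case False
    have "scaleC_blinfun (inverse c) (scaleC_blinfun c T) = T"
      using False scaleC_of_real[of 1]
      by (intro blinfun_eqI) (simp add: scaleC_blinfun.rep_eq scaleC_scaleC)
    with le[of "inverse c" "scaleC_blinfun c T"]
    have "norm T \<le> norm (scaleC_blinfun c T) / cmod c"
      by (simp add: norm_inverse divide_inverse mult.commute)
    with False have "cmod c * norm T \<le> norm (scaleC_blinfun c T)"
      by (simp add: field_simps)
    with le[of c T] show ?thesis by simp
  qed (use le[of 0 T] in simp)
qed

instantiation bop :: (complex_normed_vector) complex_unital_normed_algebra
begin

lift_definition zero_bop :: "'a bop" is 0
  by (metis blinfun.zero_left scaleC_of_real scaleR_zero_right
      vector_space_scaleC module.scale_zero_right module_iff_vector_space)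
lift_definition one_bop :: "'a bop" is id_blinfun by simp
lift_definition plus_bop :: "'a bop \<Rightarrow> 'a bop \<Rightarrow> 'a bop" is "(+)"
  by (simp add: blinfun.add_left scaleC_add_right)
lift_definition uminus_bop :: "'a bop \<Rightarrow> 'a bop" is uminus
  by (simp add: blinfun.minus_left
      module.scale_minus_right[OF vector_space_scaleC[folded module_iff_vector_space]])
lift_definition minus_bop :: "'a bop \<Rightarrow> 'a bop \<Rightarrow> 'a bop" is "(-)"
  by (simp add: blinfun.diff_left
      module.scale_right_diff_distrib[OF vector_space_scaleC[folded module_iff_vector_space]])
lift_definition times_bop :: "'a bop \<Rightarrow> 'a bop \<Rightarrow> 'a bop" is "(o\<^sub>L)"
  by simp
lift_definition scaleR_bop :: "real \<Rightarrow> 'a bop \<Rightarrow> 'a bop" is "(*\<^sub>R)"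
  by (simp add: blinfun.scaleR_left scaleC_scaleC mult.commute flip: scaleC_of_real)
lift_definition scaleC_bop :: "complex \<Rightarrow> 'a bop \<Rightarrow> 'a bop" is scaleC_blinfun
  by (simp add: scaleC_blinfun.rep_eq scaleC_scaleC mult.commute)
lift_definition norm_bop :: "'a bop \<Rightarrow> real" is norm .

definition dist_bop :: "'a bop \<Rightarrow> 'a bop \<Rightarrow> real"
  where "dist_bop S T = norm (S - T)"
definition sgn_bop :: "'a bop \<Rightarrow> 'a bop"
  where "sgn_bop T = inverse (norm T) *\<^sub>R T"
definition uniformity_bop :: "('a bop \<times> 'a bop) filter"
  where "uniformity_bop = (INF e\<in>{0 <..}. principal {(S, T). dist S T < e})"
definition open_bop :: "'a bop set \<Rightarrow> bool"
  where "open_bop U = (\<forall>S\<in>U. \<forall>\<^sub>F (S', T) in uniformity. S' = S \<longrightarrow> T \<in> U)"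

instance
proof
  fix S T R :: "'a bop" and r s :: real and c d :: complex and U :: "'a bop set"
  show "S + T + R = S + (T + R)" by transfer simp
  show "S + T = T + S" by transfer simp
  show "0 + S = S" by transfer simp
  show "- S + S = 0" by transfer simp
  show "S - T = S + - T" by transfer simp
  show "r *\<^sub>R (S + T) = r *\<^sub>R S + r *\<^sub>R T" by transfer (simp add: scaleR_add_right)
  show "(r + s) *\<^sub>R S = r *\<^sub>R S + s *\<^sub>R S" by transfer (simp add: scaleR_add_left)
  show "r *\<^sub>R s *\<^sub>R S = (r * s) *\<^sub>R S" by transfer simp
  show "1 *\<^sub>R S = S" by transfer simp
  show "dist S T = norm (S - T)" by (rule dist_bop_def)
  show "sgn S = inverse (norm S) *\<^sub>R S" by (rule sgn_bop_def)
  show "uniformity = (INF e\<in>{0 <..}. principal {(S :: 'a bop, T). dist S T < e})"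
    by (rule uniformity_bop_def)
  show "open U = (\<forall>S\<in>U. \<forall>\<^sub>F (S', T) in uniformity. S' = S \<longrightarrow> T \<in> U)"
    by (rule open_bop_def)
  show "(norm S = 0) = (S = 0)" by transfer simp
  show "norm (S + T) \<le> norm S + norm T" by transfer (rule norm_triangle_ineq)
  show "norm (r *\<^sub>R S) = \<bar>r\<bar> * norm S" by transfer simp
  show "c *\<^sub>C (S + T) = c *\<^sub>C S + c *\<^sub>C T"
    by transfer (auto intro!: blinfun_eqI
        simp: scaleC_blinfun.rep_eq blinfun.add_left scaleC_add_right)
  show "(c + d) *\<^sub>C S = c *\<^sub>C S + d *\<^sub>C S"
    by transfer (auto intro!: blinfun_eqI
        simp: scaleC_blinfun.rep_eq blinfun.add_left scaleC_add_left)
  show "c *\<^sub>C d *\<^sub>C S = (c * d) *\<^sub>C S"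
    by transfer (auto intro!: blinfun_eqI simp: scaleC_blinfun.rep_eq scaleC_scaleC)
  show "complex_of_real r *\<^sub>C S = r *\<^sub>R S"
    by transfer (auto intro!: blinfun_eqI
        simp: scaleC_blinfun.rep_eq blinfun.scaleR_left scaleC_of_real)
  show "norm (c *\<^sub>C S) = cmod c * norm S"
    by transfer (rule norm_scaleC_blinfun)
  show "S * T * R = S * (T * R)"
    by transfer (auto intro!: blinfun_eqI)
  show "(S + T) * R = S * R + T * R"
    by transfer (auto intro!: blinfun_eqI simp: blinfun.add_left)
  show "S * (T + R) = S * T + S * R"
    by transfer (auto intro!: blinfun_eqI simp: blinfun.add_left blinfun.add_right)
  show "r *\<^sub>R S * T = r *\<^sub>R (S * T)"
    by transfer (auto intro!: blinfun_eqI simp: blinfun.scaleR_left)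
  show "S * r *\<^sub>R T = r *\<^sub>R (S * T)"
    by transfer (auto intro!: blinfun_eqI simp: blinfun.scaleR_left blinfun.scaleR_right)
  show "norm (S * T) \<le> norm S * norm T"
    by transfer (rule norm_blinfun_compose)
  show "1 * S = S" by transfer (auto intro!: blinfun_eqI)
  show "S * 1 = S" by transfer (auto intro!: blinfun_eqI)
  show "c *\<^sub>C S * T = c *\<^sub>C (S * T)"
    by transfer (auto intro!: blinfun_eqI simp: scaleC_blinfun.rep_eq)
  show "S * c *\<^sub>C T = c *\<^sub>C (S * T)"
    by transfer (auto intro!: blinfun_eqI simp: scaleC_blinfun.rep_eq)
qed

end

section \<open>Ultrafilters\<close>

text \<open>A set \<open>A\<close> belongs to the filter \<open>\<alpha>\<close> iff \<open>\<forall>\<^sub>F n in \<alpha>. n \<in> A\<close>.\<close>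

definition ultrafilter :: "'a filter \<Rightarrow> bool"
  where "ultrafilter \<alpha> \<longleftrightarrow>
    \<alpha> \<noteq> bot \<and> (\<forall>A. (\<forall>\<^sub>F n in \<alpha>. n \<in> A) \<or> (\<forall>\<^sub>F n in \<alpha>. n \<in> - A))"

definition nonprincipal_ultrafilter :: "'a filter \<Rightarrow> bool"
  where "nonprincipal_ultrafilter \<alpha> \<longleftrightarrow> ultrafilter \<alpha> \<and> (\<forall>n. \<alpha> \<noteq> principal {n})"

definition finite_to_one_on :: "('a \<Rightarrow> 'b) \<Rightarrow> 'a set \<Rightarrow> bool"
  where "finite_to_one_on f A \<longleftrightarrow> (\<forall>y. finite {x \<in> A. f x = y})"

definition three_functions_property :: "nat filter \<Rightarrow> bool"
  where "three_functions_property \<alpha> \<longleftrightarrow>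
    (\<exists>\<phi> :: nat \<Rightarrow> nat \<times> nat. bij \<phi> \<and>
      (\<forall>f :: nat \<Rightarrow> nat. \<exists>A. (\<forall>\<^sub>F n in \<alpha>. n \<in> A) \<and>
        (f constant_on A \<or>
         finite_to_one_on f A \<or>
         (\<exists>g :: nat \<Rightarrow> nat. inj g \<and> (\<forall>n\<in>A. f n = (g \<circ> fst \<circ> \<phi>) n)))))"

section \<open>Ultrapowers\<close>

definition bounded_sequences :: "(nat \<Rightarrow> 'a::complex_unital_normed_algebra) ring"
  where "bounded_sequences =
    \<lparr>carrier = {x. Bseq x}, mult = (\<lambda>x y n. x n * y n), one = (\<lambda>n. 1),
     zero = (\<lambda>n. 0), add = (\<lambda>x y n. x n + y n)\<rparr>"

definition null_sequences :: "nat filter \<Rightarrow> (nat \<Rightarrow> 'a::complex_unital_normed_algebra) set"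
  where "null_sequences \<alpha> = {x. Bseq x \<and> ((\<lambda>n. norm (x n)) \<longlongrightarrow> 0) \<alpha>}"

definition ultrapower ::
    "nat filter \<Rightarrow> (nat \<Rightarrow> 'a::complex_unital_normed_algebra) set ring"
  where "ultrapower \<alpha> = bounded_sequences Quot null_sequences \<alpha>"

text \<open>The canonical embedding of the algebra into its ultrapower: the class of the constant
  sequence.\<close>

definition const_class ::
    "nat filter \<Rightarrow> 'a::complex_unital_normed_algebra \<Rightarrow> (nat \<Rightarrow> 'a) set"
  where "const_class \<alpha> a = null_sequences \<alpha> +>\<^bsub>bounded_sequences\<^esub> (\<lambda>n. a)"

definition ultrapower_commutant ::
    "nat filter \<Rightarrow> (nat \<Rightarrow> 'a::complex_unital_normed_algebra) set set"
  where "ultrapower_commutant \<alpha> =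
    {b \<in> carrier (ultrapower \<alpha>).
      \<forall>a. b \<otimes>\<^bsub>ultrapower \<alpha>\<^esub> const_class \<alpha> a = const_class \<alpha> a \<otimes>\<^bsub>ultrapower \<alpha>\<^esub> b}"

text \<open>The scalar multiples of the unit of the ultrapower, \<open>c \<cdot> [1] = [c \<cdot> 1]\<close>.\<close>

definition ultrapower_scalars ::
    "nat filter \<Rightarrow> (nat \<Rightarrow> 'a::complex_unital_normed_algebra) set set"
  where "ultrapower_scalars \<alpha> = range (\<lambda>c. const_class \<alpha> (c *\<^sub>C 1))"

lemma Bseq_add_seq:
  fixes x y :: "nat \<Rightarrow> 'a::real_normed_vector"
  assumes "Bseq x" "Bseq y"
  shows "Bseq (\<lambda>n. x n + y n)"
  using assms by (simp add: Bseq_eq_bounded bounded_plus_comp)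

lemma Bseq_mult_seq:
  fixes x y :: "nat \<Rightarrow> 'a::real_normed_algebra"
  assumes "Bseq x" "Bseq y"
  shows "Bseq (\<lambda>n. x n * y n)"
proof -
  obtain K L where KL: "\<And>n. norm (x n) \<le> K" "\<And>n. norm (y n) \<le> L"
    using assms unfolding Bseq_def by blast
  then have "norm (x n * y n) \<le> K * L" for n
    by (intro order_trans[OF norm_mult_ineq] mult_mono order_trans[OF norm_ge_zero]) auto
  then show ?thesis by (rule BseqI')
qed

lemma ring_bounded_sequences:
  "ring (bounded_sequences :: (nat \<Rightarrow> 'a::complex_unital_normed_algebra) ring)"
proof (rule ringI)
  show "abelian_group (bounded_sequences :: (nat \<Rightarrow> 'a) ring)"
  proof (rule abelian_groupI)
    fix x :: "nat \<Rightarrow> 'a" assume "x \<in> carrier bounded_sequences"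
    then show "\<exists>y\<in>carrier bounded_sequences.
        y \<oplus>\<^bsub>bounded_sequences\<^esub> x = \<zero>\<^bsub>bounded_sequences\<^esub>"
      by (intro bexI[of _ "\<lambda>n. - x n"]) (simp_all add: bounded_sequences_def Bseq_minus_iff)
  qed (auto simp: bounded_sequences_def Bseq_add_seq add.assoc add.commute)
  show "Group.monoid (bounded_sequences :: (nat \<Rightarrow> 'a) ring)"
    by (rule monoidI) (auto simp: bounded_sequences_def mult.assoc intro: Bseq_mult_seq)
qed (auto simp: bounded_sequences_def distrib_left distrib_right)

lemma ideal_null_sequences:
  "ideal (null_sequences \<alpha>)
     (bounded_sequences :: (nat \<Rightarrow> 'a::complex_unital_normed_algebra) ring)"
proof (rule idealI[OF ring_bounded_sequences])
  let ?R = "bounded_sequences :: (nat \<Rightarrow> 'a) ring"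
  interpret ring ?R by (rule ring_bounded_sequences)
  show "subgroup (null_sequences \<alpha>) (add_monoid ?R)"
  proof (rule add.subgroupI)
    fix x :: "nat \<Rightarrow> 'a" assume x: "x \<in> null_sequences \<alpha>"
    then have "x \<in> carrier ?R" by (simp add: null_sequences_def bounded_sequences_def)
    moreover have "(\<lambda>n. - x n) \<in> carrier ?R"
      using x by (simp add: null_sequences_def bounded_sequences_def Bseq_minus_iff)
    ultimately have "\<ominus>\<^bsub>?R\<^esub> x = (\<lambda>n. - x n)"
      by (intro minus_equality) (simp_all add: bounded_sequences_def)
    with x show "\<ominus>\<^bsub>?R\<^esub> x \<in> null_sequences \<alpha>"
      by (simp add: null_sequences_def Bseq_minus_iff)
  next
    show "x \<oplus>\<^bsub>?R\<^esub> y \<in> null_sequences \<alpha>"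
      if "x \<in> null_sequences \<alpha>" "y \<in> null_sequences \<alpha>" for x y
      using that tendsto_add_zero[of x \<alpha> y]
      by (auto simp: null_sequences_def bounded_sequences_def Bseq_add_seq tendsto_norm_zero_iff)
    have "(\<lambda>n. 0 :: 'a) \<in> null_sequences \<alpha>" by (simp add: null_sequences_def)
    then show "null_sequences \<alpha> \<noteq> ({} :: (nat \<Rightarrow> 'a) set)" by blast
  qed (auto simp: null_sequences_def bounded_sequences_def)
next
  fix a x :: "nat \<Rightarrow> 'a"
  assume a: "a \<in> null_sequences \<alpha>" and x: "x \<in> carrier bounded_sequences"
  from x obtain K where K: "\<And>n. norm (x n) \<le> K"
    by (auto simp: bounded_sequences_def Bseq_def)
  have lim: "((\<lambda>n. norm (a n) * K) \<longlongrightarrow> 0) \<alpha>"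
    using a by (intro tendsto_mult_left_zero) (simp add: null_sequences_def)
  have "norm (x n * a n) \<le> norm (a n) * K" "norm (a n * x n) \<le> norm (a n) * K" for n
    using norm_mult_ineq[of "x n" "a n"] norm_mult_ineq[of "a n" "x n"]
      mult_left_mono[OF K[of n] norm_ge_zero[of "a n"]]
    by (simp_all add: mult.commute)
  then have "((\<lambda>n. norm (x n * a n)) \<longlongrightarrow> 0) \<alpha>" "((\<lambda>n. norm (a n * x n)) \<longlongrightarrow> 0) \<alpha>"
    by (auto intro!: tendsto_sandwich[OF _ _ tendsto_const lim])
  then show "x \<otimes>\<^bsub>bounded_sequences\<^esub> a \<in> null_sequences \<alpha>"
    "a \<otimes>\<^bsub>bounded_sequences\<^esub> x \<in> null_sequences \<alpha>"
    using a x by (auto simp: null_sequences_def bounded_sequences_def intro: Bseq_mult_seq)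
qed

lemma ring_ultrapower: "ring (ultrapower \<alpha>)"
  unfolding ultrapower_def by (rule ideal.quotient_is_ring[OF ideal_null_sequences])

end

theory Submission
  imports Defs
begin

text \<open>Fix an orthonormal basis \<open>e\<close> of \<open>H\<close> and let \<open>Q\<^sub>j\<close> be the projection onto the closed span of
  \<open>e\<^sub>j, e\<^sub>j\<^sub>+\<^sub>1, \<dots>\<close>; \<open>inf\<^sub>j \<parallel>Q\<^sub>j T Q\<^sub>j\<parallel>\<close> measures the distance of \<open>T\<close> from the compact operators. Suppose
  that \<open>(x\<^sub>n)\<close> is bounded and \<open>\<parallel>[a, x\<^sub>n]\<parallel> \<rightarrow> 0\<close> along \<open>\<alpha>\<close> for all \<open>a\<close>. If the \<open>x\<^sub>n\<close> stayed uniformly away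
  from scalars modulo compacts, then a single operator \<open>a\<close>, assembled from rank one operators on
  consecutive blocks of the basis, one for each \<open>n\<close>, would have commutators bounded below with all
  of them. By compactness there is thus a scalar \<open>c\<close> such that \<open>y\<^sub>n = x\<^sub>n - c\<close> tends to the compacts
  along \<open>\<alpha>\<close>.

  Suppose \<open>\<parallel>y\<^sub>n\<parallel> \<ge> \<epsilon>\<close> and let \<open>f\<^sub>i(n)\<close> be the least \<open>j\<close> with \<open>\<parallel>Q\<^sub>j y\<^sub>n Q\<^sub>j\<parallel> < \<epsilon> / 2\<^sup>i\<close>. Among
  \<open>f\<^sub>0, \<dots>, f\<^sub>3\<close> two functions have the same of the three types allowed by the three functions
  property, so \<open>f\<^sub>k \<le> J \<circ> f\<^sub>i\<close> on a set in \<open>\<alpha>\<close> for some \<open>i < k\<close> and some \<open>J\<close>. An isometry \<open>a\<close> shifting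
  \<open>e\<^sub>r\<close> to \<open>e\<^sub>s\<close> with \<open>s\<close> large compared with \<open>J\<close> then moves the corner of \<open>y\<^sub>n\<close> at \<open>f\<^sub>i(n) - 1\<close>, of norm
  at least \<open>\<epsilon> / 2\<^sup>i\<close>, beyond \<open>f\<^sub>k(n)\<close>, where \<open>y\<^sub>n\<close> has norm below \<open>\<epsilon> / 2\<^sup>k\<close>; so \<open>a\<close> does not
  asymptotically commute with \<open>y\<^sub>n\<close>.\<close>

interpretation complex_vector: vector_space
  "scaleC :: complex \<Rightarrow> 'a \<Rightarrow> 'a::complex_normed_vector"
  by (rule vector_space_scaleC)

text \<open>Gives access to the Cauchy criterion \<open>summable_Cauchy\<close>, which concerns
  series in Banach spaces.\<close>

instance complex_hilbert \<subseteq> banach ..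

section \<open>Complex inner products\<close>

lemma cinner_zero_left [simp]: "cinner 0 (y::'a::complex_inner) = 0"
  using cinner_add_left[of 0 0 y] by simp

lemma cinner_zero_right [simp]: "cinner (x::'a::complex_inner) 0 = 0"
  using cinner_commute[of x 0] by simp

lemma cinner_add_right: "cinner (x::'a::complex_inner) (y + z) = cinner x y + cinner x z"
  by (metis cinner_add_left cinner_commute complex_cnj_add)

lemma cinner_scaleC_right: "cinner (x::'a::complex_inner) (c *\<^sub>C y) = cnj c * cinner x y"
  by (metis cinner_scaleC_left cinner_commute complex_cnj_mult)

lemma cinner_diff_left: "cinner ((x::'a::complex_inner) - y) z = cinner x z - cinner y z"
  using cinner_add_left[of "x - y" y z] by simp

lemma cinner_sum_left: "cinner (\<Sum>i\<in>A. f i) (y::'a::complex_inner) = (\<Sum>i\<in>A. cinner (f i) y)"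
  by (induction A rule: infinite_finite_induct) (simp_all add: cinner_add_left)

lemma cinner_sum_right: "cinner (y::'a::complex_inner) (\<Sum>i\<in>A. f i) = (\<Sum>i\<in>A. cinner y (f i))"
  by (induction A rule: infinite_finite_induct) (simp_all add: cinner_add_right)

lemma norm_add_orthogonal:
  fixes x y :: "'a::complex_inner"
  assumes "cinner x y = 0"
  shows "(norm (x + y))\<^sup>2 = (norm x)\<^sup>2 + (norm y)\<^sup>2"
proof -
  have "cinner y x = 0" using assms cinner_commute[of y x] by simp
  then have "complex_of_real ((norm (x + y))\<^sup>2) = complex_of_real ((norm x)\<^sup>2 + (norm y)\<^sup>2)"
    using assms unfolding of_real_add cinner_self[symmetric]
    by (simp add: cinner_add_left cinner_add_right)
  then show ?thesis by (simp only: of_real_eq_iff)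
qed

lemma norm_sum_orthogonal:
  fixes v :: "'i \<Rightarrow> 'a::complex_inner"
  assumes "finite F" and "\<And>i j. i \<in> F \<Longrightarrow> j \<in> F \<Longrightarrow> i \<noteq> j \<Longrightarrow> cinner (v i) (v j) = 0"
  shows "(norm (\<Sum>i\<in>F. v i))\<^sup>2 = (\<Sum>i\<in>F. (norm (v i))\<^sup>2)"
  using assms
proof (induction F rule: finite_induct)
  case (insert k F)
  have "cinner (v k) (\<Sum>i\<in>F. v i) = 0"
    unfolding cinner_sum_right using insert by (intro sum.neutral) (metis insertCI)
  with insert show ?case by (simp add: norm_add_orthogonal)
qed simp

section \<open>Orthonormal bases\<close>

locale orthonormal_sequence =
  fixes e :: "nat \<Rightarrow> 'h::complex_hilbert"
  assumes orthonormal: "cinner (e i) (e j) = (if i = j then 1 else 0)"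
begin

text \<open>The orthogonal projection onto the span of the first \<open>n\<close> vectors, evaluated
  at \<open>x\<close>.\<close>

definition partial_expansion :: "nat \<Rightarrow> 'h \<Rightarrow> 'h"
  where "partial_expansion n x = (\<Sum>i<n. cinner x (e i) *\<^sub>C e i)"

lemma norm_basis [simp]: "norm (e i) = 1"
  using cinner_self[of "e i"] power2_eq_1_iff[of "norm (e i)"] norm_ge_zero[of "e i"]
  by (auto simp: orthonormal simp flip: of_real_power simp del: norm_ge_zero)

lemma cinner_partial_expansion:
  "cinner (partial_expansion n x) (e i) = (if i < n then cinner x (e i) else 0)"
proof -
  have "cinner (partial_expansion n x) (e i) = (\<Sum>j<n. if j = i then cinner x (e j) else 0)"
    unfolding partial_expansion_def cinner_sum_left cinner_scaleC_left orthonormal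
    by (rule sum.cong) auto
  then show ?thesis by (simp add: sum.delta)
qed

lemma partial_expansion_diff:
  "partial_expansion n (x - y) = partial_expansion n x - partial_expansion n y"
  by (simp add: partial_expansion_def cinner_diff_left complex_vector.scale_left_diff_distrib
      sum_subtractf)

text \<open>Pythagoras twice: the remainder is orthogonal to the projection, and the terms of the
  projection are orthogonal to each other.\<close>

lemma norm_expansion_decompose:
  "(norm x)\<^sup>2 = (norm (x - partial_expansion n x))\<^sup>2 + (\<Sum>i<n. (cmod (cinner x (e i)))\<^sup>2)"
proof -
  let ?s = "partial_expansion n x"
  have "cinner (x - ?s) ?s = (\<Sum>i<n. cnj (cinner x (e i)) * cinner (x - ?s) (e i))"
    by (simp add: partial_expansion_def[of n x] cinner_sum_right cinner_scaleC_right)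
  also have "\<dots> = 0"
    by (intro sum.neutral) (simp add: cinner_diff_left cinner_partial_expansion)
  finally have "(norm x)\<^sup>2 = (norm (x - ?s))\<^sup>2 + (norm ?s)\<^sup>2"
    using norm_add_orthogonal[of "x - ?s" ?s] by simp
  also have "(norm ?s)\<^sup>2 = (\<Sum>i<n. (cmod (cinner x (e i)))\<^sup>2)"
  proof -
    have "(norm ?s)\<^sup>2 = (\<Sum>i<n. (norm (cinner x (e i) *\<^sub>C e i))\<^sup>2)"
      unfolding partial_expansion_def
      by (rule norm_sum_orthogonal)
        (simp_all add: cinner_scaleC_left cinner_scaleC_right orthonormal)
    then show ?thesis by (simp only: norm_scaleC norm_basis mult_1_right)
  qed
  finally show ?thesis .
qed

lemma bessel: "(\<Sum>i<n. (cmod (cinner x (e i)))\<^sup>2) \<le> (norm x)\<^sup>2"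
  using norm_expansion_decompose[of x n] zero_le_power2[of "norm (x - partial_expansion n x)"]
  by linarith

lemma norm_expansion_remainder: "norm (x - partial_expansion n x) \<le> norm x"
proof (rule power2_le_imp_le)
  have "0 \<le> (\<Sum>i<n. (cmod (cinner x (e i)))\<^sup>2)" by (simp add: sum_nonneg)
  then show "(norm (x - partial_expansion n x))\<^sup>2 \<le> (norm x)\<^sup>2"
    using norm_expansion_decompose[of x n] by linarith
qed simp

lemma partial_expansion_span:
  assumes "x \<in> complex_vector.span (e ` {..<m})" "m \<le> n"
  shows "partial_expansion n x = x"
  using assms(1)
proof (induction rule: complex_vector.span_induct_alt)
  case base
  show ?case by (simp add: partial_expansion_def)
next
  case (step c x y)
  then obtain k where k: "x = e k" "k < m" by blast
  have "partial_expansion n (c *\<^sub>C x) = (\<Sum>i<n. if i = k then c *\<^sub>C e i else 0)"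
    unfolding partial_expansion_def k cinner_scaleC_left orthonormal
    by (rule sum.cong) auto
  then have "partial_expansion n (c *\<^sub>C x) = c *\<^sub>C x" using k assms(2) by (simp add: sum.delta)
  with step show ?case
    by (simp add: partial_expansion_def cinner_add_left complex_vector.scale_left_distrib sum.distrib)
qed

lemma partial_expansion_in_span: "partial_expansion n x \<in> complex_vector.span (e ` {..<n})"
  unfolding partial_expansion_def
  by (intro complex_vector.span_sum complex_vector.span_scale complex_vector.span_base) auto

end

text \<open>Completeness is encoded as convergence of the expansions because operators are built and
  compared below as limits along them.\<close>

locale hilbert_basis = orthonormal_sequence e
  for e :: "nat \<Rightarrow> 'h::complex_hilbert" +
  assumes partial_expansion_tendsto: "(\<lambda>n. partial_expansion n x) \<longlonglongrightarrow> x"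

section \<open>Gram-Schmidt orthonormalisation of a dense sequence\<close>

text \<open>One Gram-Schmidt step: subtract from \<open>x\<close> its projection \<open>s\<close>
  onto the span and normalise the remainder, which is nonzero as \<open>x\<close> is outside the
  span.\<close>

lemma exists_orthogonal_unit:
  fixes f :: "nat \<Rightarrow> 'h::complex_inner"
  assumes on: "\<And>i j. i < n \<Longrightarrow> j < n \<Longrightarrow> cinner (f i) (f j) = (if i = j then 1 else 0)"
    and x: "x \<notin> complex_vector.span (f ` {..<n})"
  shows "\<exists>r. norm r = 1 \<and> (\<forall>i<n. cinner r (f i) = 0) \<and> x \<in> complex_vector.span (insert r (f ` {..<n}))"
proof -
  define s where "s = (\<Sum>i<n. cinner x (f i) *\<^sub>C f i)"
  define r where "r = complex_of_real (1 / norm (x - s)) *\<^sub>C (x - s)"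
  have s: "s \<in> complex_vector.span (f ` {..<n})"
    unfolding s_def
    by (intro complex_vector.span_sum complex_vector.span_scale complex_vector.span_base) auto
  with x have ne: "x - s \<noteq> 0" by auto
  have "cinner (x - s) (f i) = 0" if "i < n" for i
  proof -
    have "cinner s (f i) = (\<Sum>j<n. if j = i then cinner x (f j) else 0)"
      unfolding s_def cinner_sum_left cinner_scaleC_left using that on
      by (intro sum.cong) auto
    with that show ?thesis by (simp add: cinner_diff_left sum.delta)
  qed
  then have orth: "\<forall>i<n. cinner r (f i) = 0" by (simp add: r_def cinner_scaleC_left)
  have norm_r: "norm r = 1" using ne by (simp add: r_def norm_scaleC norm_divide)
  have x_eq: "x = complex_of_real (norm (x - s)) *\<^sub>C r + s"
    using ne by (simp add: r_def complex_vector.scale_scale flip: of_real_mult)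
  have "x \<in> complex_vector.span (insert r (f ` {..<n}))"
  proof (subst x_eq, rule complex_vector.span_add)
    show "s \<in> complex_vector.span (insert r (f ` {..<n}))"
      using s complex_vector.span_mono[OF subset_insertI] by blast
    show "complex_of_real (norm (x - s)) *\<^sub>C r \<in> complex_vector.span (insert r (f ` {..<n}))"
      by (intro complex_vector.span_scale complex_vector.span_base) simp
  qed
  with orth norm_r show ?thesis by blast
qed

text \<open>Gram-Schmidt runs along a dense sequence \<open>d\<close> but adds exactly one vector at
  every stage: if \<open>d n\<close> is already in the span, infinite dimension supplies another
  vector to orthonormalise.\<close>

lemma exists_hilbert_basis:
  assumes "separable_space (euclidean :: 'h::complex_hilbert topology)"
    and "infinite_dimensional TYPE('h)"
  shows "\<exists>e :: nat \<Rightarrow> 'h. hilbert_basis e"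
proof -
  obtain D :: "'h set" where D: "countable D" "closure D = UNIV"
    using assms(1) unfolding separable_space_def by auto
  then have "D \<noteq> {}" by auto
  define d where "d = from_nat_into D"
  have ranged: "range d = D" unfolding d_def by (rule range_from_nat_into) fact+
  define P where "P = (\<lambda>f n (r::'h). norm r = 1 \<and> (\<forall>i<n. cinner r (f i) = 0) \<and>
      d n \<in> complex_vector.span (insert r (f ` {..<n})))"
  have on: "cinner (f i) (f j) = (if i = j then 1 else 0)"
    if "\<And>m. m < n \<Longrightarrow> P f m (f m)" "i < n" "j < n" for f i j n
  proof (cases i j rule: linorder_cases)
    case less
    then have "cinner (f j) (f i) = 0" using that unfolding P_def by blast
    then show ?thesis using less cinner_commute[of "f i" "f j"] by simp
  next
    case equal
    then show ?thesis using that(1)[of i] that(2) cinner_self[of "f i"] by (simp add: P_def)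
  next
    case greater
    then show ?thesis using that(1)[of i] that(2) by (simp add: P_def)
  qed
  \<comment> \<open>Course-of-values recursion: \<open>P f n r\<close> depends on \<open>f\<close>
    only below \<open>n\<close>.\<close>
  have "\<exists>e. \<forall>n. P e n (e n)"
  proof (rule dependent_wellorder_choice)
    show "P f n r = P g n r" if "\<And>m. m < n \<Longrightarrow> f m = g m" for f g n r
    proof -
      have "f ` {..<n} = g ` {..<n}" using that by (intro image_cong) auto
      moreover have "(\<forall>i<n. cinner r (f i) = 0) \<longleftrightarrow> (\<forall>i<n. cinner r (g i) = 0)"
        using that by metis
      ultimately show ?thesis unfolding P_def by (simp only:)
    qed
    show "\<exists>r. P f n r" if f: "\<And>m. m < n \<Longrightarrow> P f m (f m)" for n f
    proof (cases "d n \<in> complex_vector.span (f ` {..<n})")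
      case True
      have "complex_vector.span (f ` {..<n}) \<noteq> UNIV"
        using assms(2) unfolding infinite_dimensional_def by blast
      then obtain x where "x \<notin> complex_vector.span (f ` {..<n})" by blast
      from exists_orthogonal_unit[OF on[where n = n and f = f, OF f] this] obtain r
        where "norm r = 1" "\<forall>i<n. cinner r (f i) = 0" by blast
      moreover have "d n \<in> complex_vector.span (insert r (f ` {..<n}))"
        using True complex_vector.span_mono[OF subset_insertI] by blast
      ultimately show ?thesis unfolding P_def by blast
    next
      case False
      from exists_orthogonal_unit[OF on[where n = n and f = f, OF f] this] show ?thesis unfolding P_def by blast
    qed
  qed
  then obtain e where e: "\<And>n. P e n (e n)" by blast
  interpret orthonormal_sequence e
  proof
    show "cinner (e i) (e j) = (if i = j then 1 else 0)" for i j
      using on[of "Suc (max i j)" e i j] e by auto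
  qed
  have dn: "partial_expansion n (d m) = d m" if "m < n" for m n
  proof (rule partial_expansion_span)
    have "insert (e m) (e ` {..<m}) = e ` {..<Suc m}" by (auto simp: less_Suc_eq)
    then show "d m \<in> complex_vector.span (e ` {..<Suc m})" using e[of m] unfolding P_def by metis
  qed (use that in simp)
  have "(\<lambda>n. partial_expansion n x) \<longlonglongrightarrow> x" for x
  proof (rule LIMSEQ_I)
    fix r :: real assume "0 < r"
    then obtain y where "y \<in> D" "dist y x < r"
      using D(2) closure_approachable[of x D] by auto
    then obtain m where m: "norm (x - d m) < r" 
      using ranged by (auto simp: dist_norm norm_minus_commute)
    have "norm (partial_expansion n x - x) < r" if "m < n" for n
    proof -
      \<comment> \<open>The expansion reproduces \<open>d m\<close>, so \<open>x\<close> and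
        \<open>x - d m\<close> have the same remainder.\<close>
      have "x - partial_expansion n x = (x - d m) - partial_expansion n (x - d m)"
        using dn[OF that] by (simp add: partial_expansion_diff)
      then have "norm (x - partial_expansion n x) \<le> norm (x - d m)"
        using norm_expansion_remainder[of "x - d m" n] by metis
      then show ?thesis using m by (simp add: norm_minus_commute)
    qed
    then show "\<exists>n0. \<forall>n\<ge>n0. norm (partial_expansion n x - x) < r"
      by (auto intro!: exI[of _ "Suc m"])
  qed
  then show ?thesis by (intro exI[of _ e]) (unfold_locales, auto)
qed

section \<open>Operators prescribed on a basis\<close>

lemma bop_apply_one [simp]: "bop_apply 1 x = x" by transfer simp
lemma bop_apply_diff: "bop_apply (S - T) x = bop_apply S x - bop_apply T x"
  by transfer (simp add: blinfun.diff_left)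
lemma bop_apply_mult: "bop_apply (S * T) x = bop_apply S (bop_apply T x)"
  by transfer simp
lemma bop_apply_scaleC: "bop_apply (c *\<^sub>C S) x = c *\<^sub>C bop_apply S x"
  by transfer (simp add: scaleC_blinfun.rep_eq)

lemma bounded_linear_bop_apply: "bounded_linear (bop_apply T)"
  by transfer (rule blinfun.bounded_linear_right)

lemmas bop_sum = linear_sum[OF bounded_linear.linear[OF bounded_linear_bop_apply]]
  and bop_add_right = linear_add[OF bounded_linear.linear[OF bounded_linear_bop_apply]]
  and bop_diff_right = linear_diff[OF bounded_linear.linear[OF bounded_linear_bop_apply]]
  and bop_zero_right [simp] = linear_0[OF bounded_linear.linear[OF bounded_linear_bop_apply]]
  and bop_tendsto = bounded_linear.tendsto[OF bounded_linear_bop_apply]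

lemma bop_apply_scaleC_right: "bop_apply T (c *\<^sub>C x) = c *\<^sub>C bop_apply T x"
  by transfer simp

lemma norm_bop_apply: "norm (bop_apply T x) \<le> norm T * norm x"
  by transfer (rule norm_blinfun)

lemma norm_bop_bound:
  "(\<And>x. norm (bop_apply T x) \<le> K * norm x) \<Longrightarrow> 0 \<le> K \<Longrightarrow> norm T \<le> K"
  by transfer (rule norm_blinfun_bound)

lemma bop_eqI: "(\<And>x. bop_apply S x = bop_apply T x) \<Longrightarrow> S = T"
  by transfer (rule blinfun_eqI)

lemma exists_bop:
  fixes f :: "'h::complex_normed_vector \<Rightarrow> 'h"
  assumes "bounded_linear f" and "\<And>c x. f (c *\<^sub>C x) = c *\<^sub>C f x"
  shows "\<exists>T. bop_apply T = f"
  by (rule exI[of _ "Abs_bop (Blinfun f)"])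
    (simp add: bop_apply.rep_eq Abs_bop_inverse bounded_linear_Blinfun_apply assms)

lemma norm_mult3_le:
  fixes a b c :: "'a::real_normed_algebra"
  assumes "norm a \<le> 1" "norm c \<le> 1"
  shows "norm (a * b * c) \<le> norm b"
proof -
  have "norm (a * b * c) \<le> norm (a * b) * norm c" by (rule norm_mult_ineq)
  also have "\<dots> \<le> norm (a * b)" using assms(2) by (simp add: mult_left_le)
  also have "\<dots> \<le> norm a * norm b" by (rule norm_mult_ineq)
  also have "\<dots> \<le> norm b" using assms(1) by (simp add: mult_left_le_one_le)
  finally show ?thesis .
qed

text \<open>Norms at most 1, rather than equal to 1, admit zero vectors, so that operators killing
  some basis vectors can be prescribed as well.\<close>

definition orthogonal_contraction :: "(nat \<Rightarrow> 'a::complex_inner) \<Rightarrow> bool"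
  where "orthogonal_contraction v \<longleftrightarrow>
    (\<forall>i. norm (v i) \<le> 1) \<and> (\<forall>i j. i \<noteq> j \<longrightarrow> cinner (v i) (v j) = 0)"

context hilbert_basis
begin

lemma norm_weighted_sum_le:
  fixes v :: "nat \<Rightarrow> 'h"
  assumes "orthogonal_contraction v"
  shows "(norm (\<Sum>i\<in>{m..<n}. cinner x (e i) *\<^sub>C v i))\<^sup>2
    \<le> (\<Sum>i\<in>{m..<n}. (cmod (cinner x (e i)))\<^sup>2)"
proof -
  have "(norm (\<Sum>i\<in>{m..<n}. cinner x (e i) *\<^sub>C v i))\<^sup>2
      = (\<Sum>i\<in>{m..<n}. (norm (cinner x (e i) *\<^sub>C v i))\<^sup>2)"
    using assms by (intro norm_sum_orthogonal)
      (auto simp: orthogonal_contraction_def cinner_scaleC_left cinner_scaleC_right)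
  also have "\<dots> \<le> (\<Sum>i\<in>{m..<n}. (cmod (cinner x (e i)))\<^sup>2)"
    using assms unfolding norm_scaleC orthogonal_contraction_def
    by (intro sum_mono power_mono) (simp_all add: mult_left_le)
  finally show ?thesis .
qed

text \<open>Orthogonality bounds the squared norm of each block of the series by the same block of
  squared coefficients, and these are summable by Bessel's inequality.\<close>

lemma summable_weighted:
  fixes v :: "nat \<Rightarrow> 'h"
  assumes "orthogonal_contraction v"
  shows "summable (\<lambda>i. cinner x (e i) *\<^sub>C v i)"
proof -
  have "summable (\<lambda>i. (cmod (cinner x (e i)))\<^sup>2)"
    by (rule summableI_nonneg_bounded[OF _ bessel]) simp
  then have C: "\<exists>N. \<forall>m\<ge>N. \<forall>n. norm (\<Sum>i\<in>{m..<n}. (cmod (cinner x (e i)))\<^sup>2) < r" if "0 < r" for r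
    using that unfolding summable_Cauchy by blast
  show ?thesis
    unfolding summable_Cauchy
  proof (intro allI impI)
    fix r :: real assume r: "0 < r"
    obtain N where N: "\<And>m n. N \<le> m \<Longrightarrow> norm (\<Sum>i\<in>{m..<n}. (cmod (cinner x (e i)))\<^sup>2) < r\<^sup>2"
      using C[of "r\<^sup>2"] r by auto
    have "norm (\<Sum>i\<in>{m..<n}. cinner x (e i) *\<^sub>C v i) < r" if "N \<le> m" for m n
    proof (rule power2_less_imp_less)
      have "(\<Sum>i\<in>{m..<n}. (cmod (cinner x (e i)))\<^sup>2) < r\<^sup>2"
        using N[OF that, of n] by (simp add: sum_nonneg)
      then show "(norm (\<Sum>i\<in>{m..<n}. cinner x (e i) *\<^sub>C v i))\<^sup>2 < r\<^sup>2"
        using norm_weighted_sum_le[OF assms, where m = m and n = n and x = x] by linarith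
    qed (use r in simp)
    then show "\<exists>N. \<forall>m\<ge>N. \<forall>n. norm (\<Sum>i\<in>{m..<n}. cinner x (e i) *\<^sub>C v i) < r" by blast
  qed
qed

text \<open>The operator is the limit of the sums of \<open>cinner x (e i) *\<^sub>C v i\<close>.
  Linearity passes to the limit, and so does the norm bound given by orthogonality and Bessel's
  inequality.\<close>

lemma exists_bop_on_basis:
  fixes v :: "nat \<Rightarrow> 'h"
  assumes "orthogonal_contraction v"
  shows "\<exists>T :: 'h bop. norm T \<le> 1 \<and> (\<forall>i. bop_apply T (e i) = v i)"
proof -
  define f where "f x = (\<Sum>i. cinner x (e i) *\<^sub>C v i)" for x
  have lim: "(\<lambda>n. \<Sum>i<n. cinner x (e i) *\<^sub>C v i) \<longlonglongrightarrow> f x" for x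
    unfolding f_def by (rule summable_LIMSEQ[OF summable_weighted[OF assms]])
  have scaleC: "f (c *\<^sub>C x) = c *\<^sub>C f x" for c x
  proof (rule LIMSEQ_unique[OF lim])
    show "(\<lambda>n. \<Sum>i<n. cinner (c *\<^sub>C x) (e i) *\<^sub>C v i) \<longlonglongrightarrow> c *\<^sub>C f x"
      using bounded_linear.tendsto[OF bounded_linear_scaleC lim]
      by (simp add: cinner_scaleC_left complex_vector.scale_sum_right)
  qed
  have norm_le: "norm (f x) \<le> norm x" for x
  proof (rule LIMSEQ_le_const2[OF tendsto_norm[OF lim]], intro exI[of _ 0] allI impI)
    fix n
    have "(norm (\<Sum>i<n. cinner x (e i) *\<^sub>C v i))\<^sup>2 \<le> (norm x)\<^sup>2"
      using norm_weighted_sum_le[OF assms, where m = 0 and n = n and x = x] bessel[of x n]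
      unfolding atLeast0LessThan by linarith
    then show "norm (\<Sum>i<n. cinner x (e i) *\<^sub>C v i) \<le> norm x"
      by (rule power2_le_imp_le) simp
  qed
  have "bounded_linear f"
  proof
    show "f (x + y) = f x + f y" for x y
    proof (rule LIMSEQ_unique[OF lim])
      show "(\<lambda>n. \<Sum>i<n. cinner (x + y) (e i) *\<^sub>C v i) \<longlonglongrightarrow> f x + f y"
        using tendsto_add[OF lim lim, of x y]
        by (simp add: cinner_add_left complex_vector.scale_left_distrib sum.distrib)
    qed
    show "f (r *\<^sub>R x) = r *\<^sub>R f x" for r x
      using scaleC[of "complex_of_real r" x] by (simp add: scaleC_of_real)
    show "\<exists>K. \<forall>x. norm (f x) \<le> norm x * K" by (intro exI[of _ 1]) (simp add: norm_le)
  qed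
  then obtain T where T: "bop_apply T = f" using exists_bop scaleC by blast
  have "bop_apply T (e k) = v k" for k
    unfolding T
  proof (rule LIMSEQ_unique[OF lim], rule tendsto_eventually)
    have "(\<Sum>i<n. cinner (e k) (e i) *\<^sub>C v i) = v k" if "k < n" for n
    proof -
      have "(\<Sum>i<n. cinner (e k) (e i) *\<^sub>C v i) = (\<Sum>i<n. if i = k then v i else 0)"
        by (intro sum.cong) (auto simp: orthonormal)
      with that show ?thesis by (simp add: sum.delta)
    qed
    then show "\<forall>\<^sub>F n in sequentially. (\<Sum>i<n. cinner (e k) (e i) *\<^sub>C v i) = v k"
      by (intro eventually_sequentiallyI[of "Suc k"]) simp
  qed
  moreover have "norm T \<le> 1" by (rule norm_bop_bound) (simp_all add: T norm_le)
  ultimately show ?thesis by blast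
qed

lemma bop_eq_on_basisI:
  assumes "\<And>i. bop_apply S (e i) = bop_apply T (e i)"
  shows "S = T"
proof (rule bop_eqI)
  fix x
  have "bop_apply S (partial_expansion n x) = bop_apply T (partial_expansion n x)" for n
    by (simp add: partial_expansion_def bop_sum bop_apply_scaleC_right assms)
  then show "bop_apply S x = bop_apply T x"
    using bop_tendsto[OF partial_expansion_tendsto, of S x]
      bop_tendsto[OF partial_expansion_tendsto, of T x] by (auto intro: LIMSEQ_unique)
qed

section \<open>Projections onto tails of the basis\<close>

text \<open>By \<open>bop_eq_on_basisI\<close> the chosen operator is unique.\<close>

definition tail_projection :: "nat \<Rightarrow> 'h bop"
  where "tail_projection n =
    (SOME T. norm T \<le> 1 \<and> (\<forall>i. bop_apply T (e i) = (if i < n then 0 else e i)))"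

lemma norm_tail_projection: "norm (tail_projection n) \<le> 1"
  and tail_projection_basis: "bop_apply (tail_projection n) (e i) = (if i < n then 0 else e i)"
proof -
  have "orthogonal_contraction (\<lambda>i. if i < n then 0 else e i)"
    by (simp add: orthogonal_contraction_def orthonormal)
  from someI_ex[OF exists_bop_on_basis[OF this]]
  show "norm (tail_projection n) \<le> 1"
    "bop_apply (tail_projection n) (e i) = (if i < n then 0 else e i)"
    unfolding tail_projection_def by blast+
qed

lemma tail_projection_zero [simp]: "tail_projection 0 = 1"
  by (rule bop_eq_on_basisI) (simp add: tail_projection_basis)

lemma norm_tail_projection_apply: "norm (bop_apply (tail_projection n) x) \<le> norm x"
  using order_trans[OF norm_bop_apply mult_right_mono[OF norm_tail_projection norm_ge_zero]]
  by simp

text \<open>On partial expansions of length at least \<open>n\<close> this is a finite computation;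
  the limit gives it at \<open>x\<close>.\<close>

lemma tail_projection_apply: "bop_apply (tail_projection n) x = x - partial_expansion n x"
proof (rule LIMSEQ_unique[OF bop_tendsto[OF partial_expansion_tendsto]])
  have "bop_apply (tail_projection n) (partial_expansion m x)
      = partial_expansion m x - partial_expansion n x" if "n \<le> m" for m
  proof -
    have "bop_apply (tail_projection n) (partial_expansion m x)
        = (\<Sum>i<m. if i < n then 0 else cinner x (e i) *\<^sub>C e i)"
      unfolding partial_expansion_def
      by (auto simp: bop_sum bop_apply_scaleC_right tail_projection_basis intro!: sum.cong)
    also have "\<dots> = (\<Sum>i<m. cinner x (e i) *\<^sub>C e i) - (\<Sum>i<m. if i < n then cinner x (e i) *\<^sub>C e i else 0)"
      by (auto simp flip: sum_subtractf intro!: sum.cong)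
    also have "(\<Sum>i<m. if i < n then cinner x (e i) *\<^sub>C e i else 0) = partial_expansion n x"
      unfolding partial_expansion_def using that
      by (intro sum.mono_neutral_cong_right) auto
    finally show ?thesis by (simp add: partial_expansion_def)
  qed
  then have "\<forall>\<^sub>F m in sequentially. partial_expansion m x - partial_expansion n x
      = bop_apply (tail_projection n) (partial_expansion m x)"
    by (intro eventually_sequentiallyI[of n]) simp
  then show "(\<lambda>m. bop_apply (tail_projection n) (partial_expansion m x))
      \<longlonglongrightarrow> x - partial_expansion n x"
    using tendsto_diff[OF partial_expansion_tendsto tendsto_const] by (rule Lim_transform_eventually[rotated])
qed

lemma tail_projection_tendsto: "(\<lambda>n. bop_apply (tail_projection n) x) \<longlonglongrightarrow> 0"
  unfolding tail_projection_apply
  using tendsto_diff[OF tendsto_const partial_expansion_tendsto, of x x] by simp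

end

section \<open>Operators with large commutators\<close>

context hilbert_basis
begin

lemma norm_partial_expansion: "norm (partial_expansion n x) \<le> norm x"
proof (rule power2_le_imp_le)
  have "partial_expansion n (partial_expansion n x) = partial_expansion n x"
    by (rule partial_expansion_span[OF partial_expansion_in_span order_refl])
  then show "(norm (partial_expansion n x))\<^sup>2 \<le> (norm x)\<^sup>2"
    using norm_expansion_decompose[of "partial_expansion n x" n] bessel[of x n]
    by (simp add: cinner_partial_expansion)
qed simp

lemma tail_projection_mult: "n \<le> m \<Longrightarrow> tail_projection m * tail_projection n = tail_projection m"
  by (rule bop_eq_on_basisI) (auto simp: bop_apply_mult tail_projection_basis)

lemma tail_projection_partial_expansion:
  "m \<le> n \<Longrightarrow> bop_apply (tail_projection n) (partial_expansion m x) = 0"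
  by (simp add: tail_projection_apply partial_expansion_span[OF partial_expansion_in_span])

text \<open>\<open>x\<close> lies in the span of the first \<open>n\<close> basis vectors, while
  \<open>y\<close> has no coefficients there.\<close>

lemma tail_projection_orthogonal:
  assumes "bop_apply (tail_projection n) x = 0" "bop_apply (tail_projection n) y = y"
  shows "cinner x y = 0"
proof -
  have x: "x = partial_expansion n x" and y: "partial_expansion n y = 0"
    using assms by (simp_all add: tail_projection_apply)
  have "cinner (e i) y = 0" if "i < n" for i
    using cinner_partial_expansion[of n y i] that y cinner_commute[of "e i" y] by simp
  then have "cinner (partial_expansion n x) y = 0"
    unfolding partial_expansion_def by (simp add: cinner_sum_left cinner_scaleC_left)
  with x show ?thesis by simp
qed

text \<open>Supplies one block of the operator built below. A unit vector on which the corner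
  exceeds half its bound is truncated to finitely many coordinates; a large \<open>m\<close> serves
  both this truncation and the smallness of the tail of \<open>y\<close>.\<close>

lemma exists_far_from_scalar_vector:
  fixes S :: "'h bop"
  assumes "0 < \<epsilon>" and S: "\<And>c. \<epsilon> \<le> norm (tail_projection n * (S - c *\<^sub>C 1) * tail_projection n)"
  shows "\<exists>\<xi> m. n < m \<and> norm \<xi> \<le> 1 \<and> bop_apply (tail_projection n) \<xi> = \<xi> \<and>
    bop_apply (tail_projection m) \<xi> = 0 \<and>
    \<epsilon> / 2 \<le> norm (bop_apply (tail_projection n) (bop_apply S \<xi>) - c *\<^sub>C \<xi>) \<and>
    norm (bop_apply (tail_projection m) y) \<le> \<epsilon> / 4"
proof -
  let ?Q = tail_projection
  define R where "R = ?Q n * (S - c *\<^sub>C 1) * ?Q n"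
  have "\<exists>x. \<epsilon> / 2 * norm x < norm (bop_apply R x)"
  proof (rule ccontr)
    assume "\<not> ?thesis"
    then have "norm R \<le> \<epsilon> / 2" using assms(1) by (intro norm_bop_bound) (auto simp: not_less)
    with S[of c] assms(1) show False by (simp add: R_def)
  qed
  then obtain x0 where x0: "\<epsilon> / 2 * norm x0 < norm (bop_apply R x0)" by blast
  then have "x0 \<noteq> 0" by auto
  define x where "x = complex_of_real (1 / norm x0) *\<^sub>C x0"
  have x: "norm x = 1" "\<epsilon> / 2 < norm (bop_apply R x)"
    using x0 \<open>x0 \<noteq> 0\<close>
    by (simp_all add: x_def bop_apply_scaleC_right norm_scaleC norm_divide field_simps)
  have "(\<lambda>m. norm (bop_apply R (partial_expansion m x))) \<longlonglongrightarrow> norm (bop_apply R x)"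
    by (intro tendsto_norm bop_tendsto partial_expansion_tendsto)
  then have ev: "\<forall>\<^sub>F m in sequentially. \<epsilon> / 2 < norm (bop_apply R (partial_expansion m x))"
    using x(2) by (rule order_tendstoD)
  have "\<forall>\<^sub>F m in sequentially. norm (bop_apply (?Q m) y) < \<epsilon> / 4"
    using tendsto_norm[OF tail_projection_tendsto, of y] assms(1) by (intro order_tendstoD(2)) auto
  with ev eventually_gt_at_top[of n]
  have "\<forall>\<^sub>F m in sequentially. n < m \<and> \<epsilon> / 2 < norm (bop_apply R (partial_expansion m x))
      \<and> norm (bop_apply (?Q m) y) < \<epsilon> / 4"
    by eventually_elim simp
  then obtain m where m: "n < m" "\<epsilon> / 2 < norm (bop_apply R (partial_expansion m x))"
      "norm (bop_apply (?Q m) y) < \<epsilon> / 4"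
    using eventually_happens'[OF sequentially_bot] by blast
  \<comment> \<open>The part of \<open>x\<close> supported on the coordinates from \<open>n\<close>
    to \<open>m - 1\<close>.\<close>
  define \<xi> where "\<xi> = bop_apply (?Q n) (partial_expansion m x)"
  have fix_n: "bop_apply (?Q n) \<xi> = \<xi>"
    unfolding \<xi>_def bop_apply_mult[symmetric] by (simp add: tail_projection_mult)
  have kill_m: "bop_apply (?Q m) \<xi> = 0"
    unfolding \<xi>_def bop_apply_mult[symmetric] using m(1)
    by (simp add: tail_projection_mult tail_projection_partial_expansion)
  have "norm \<xi> \<le> 1"
    unfolding \<xi>_def using norm_tail_projection_apply[of n "partial_expansion m x"]
      norm_partial_expansion[of m x] x(1) by linarith
  moreover have "bop_apply R (partial_expansion m x) = bop_apply (?Q n) (bop_apply S \<xi>) - c *\<^sub>C \<xi>"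
    unfolding R_def using fix_n
    by (simp add: bop_apply_mult bop_apply_diff bop_apply_scaleC bop_diff_right
        bop_apply_scaleC_right flip: \<xi>_def)
  ultimately show ?thesis using m fix_n kill_m by (intro exI[of _ \<xi>] exI[of _ m]) auto
qed

text \<open>The inverse of \<open>N\<close> transports \<open>v\<close> to \<open>range N\<close>,
  and filling up with zeros keeps the family orthogonal.\<close>

lemma exists_bop_on_subsequence:
  fixes v :: "nat \<Rightarrow> 'h"
  assumes "inj N" and v: "orthogonal_contraction v"
  shows "\<exists>T :: 'h bop. norm T \<le> 1 \<and> (\<forall>k. bop_apply T (e (N k)) = v k) \<and>
    (\<forall>i. i \<notin> range N \<longrightarrow> bop_apply T (e i) = 0)"
proof -
  define w where "w i = (if i \<in> range N then v (inv_into UNIV N i) else 0)" for i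
  have w_N: "w (N k) = v k" for k using assms(1) by (simp add: w_def)
  have w_other: "w i = 0" if "i \<notin> range N" for i using that by (simp add: w_def)
  have "orthogonal_contraction w"
    unfolding orthogonal_contraction_def
  proof (intro conjI allI impI)
    show "norm (w i) \<le> 1" for i
      using v by (simp add: w_def orthogonal_contraction_def)
    show "cinner (w i) (w j) = 0" if "i \<noteq> j" for i j
    proof (cases "i \<in> range N \<and> j \<in> range N")
      case True
      then obtain k l where kl: "i = N k" "j = N l" by blast
      with that have "k \<noteq> l" by blast
      with v show ?thesis by (simp add: kl w_N orthogonal_contraction_def)
    qed (auto simp: w_other)
  qed
  from exists_bop_on_basis[OF this] w_N w_other show ?thesis by metis
qed

text \<open>Let \<open>a\<close> send \<open>e (N k)\<close> to a vector \<open>\<xi> k\<close>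
  supported between \<open>N k\<close> and \<open>N (Suc k)\<close>, and kill the other basis
  vectors. At \<open>e (N k)\<close>, and cut down by the tail projection at \<open>N k\<close>, the
  commutator is a multiple of \<open>\<xi> k\<close> minus the compressed \<open>T k\<close> at
  \<open>\<xi> k\<close>, up to an error of norm at most \<epsilon>/4. The choice of
  \<open>\<xi> k\<close> keeps this difference at norm at least \<epsilon>/2.\<close>

lemma exists_commutators_bounded_below:
  fixes T :: "nat \<Rightarrow> 'h bop"
  assumes "0 < \<epsilon>"
    and T: "\<And>k c j. \<epsilon> \<le> norm (tail_projection j * (T k - c *\<^sub>C 1) * tail_projection j)"
  shows "\<exists>a. \<forall>k. \<epsilon> / 4 \<le> norm (a * T k - T k * a)"
proof -
  let ?Q = tail_projection
  \<comment> \<open>The diagonal coefficient is all that survives from the coordinates of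
    \<open>T k\<close> at \<open>e n\<close> below the end of the block, so it is the scalar that
    \<open>\<xi>\<close> has to avoid.\<close>
  define c where "c k n = cinner (bop_apply (T k) (e n)) (e n)" for k n
  have "\<forall>k n. \<exists>\<xi> m. n < m \<and> norm \<xi> \<le> 1 \<and> bop_apply (?Q n) \<xi> = \<xi> \<and> bop_apply (?Q m) \<xi> = 0 \<and>
    \<epsilon> / 2 \<le> norm (bop_apply (?Q n) (bop_apply (T k) \<xi>) - c k n *\<^sub>C \<xi>) \<and>
    norm (bop_apply (?Q m) (bop_apply (T k) (e n))) \<le> \<epsilon> / 4"
    by (intro allI exists_far_from_scalar_vector assms)
  then obtain X M where XM: "\<And>k n. n < M k n \<and> norm (X k n) \<le> 1 \<and>
    bop_apply (?Q n) (X k n) = X k n \<and> bop_apply (?Q (M k n)) (X k n) = 0 \<and>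
    \<epsilon> / 2 \<le> norm (bop_apply (?Q n) (bop_apply (T k) (X k n)) - c k n *\<^sub>C X k n) \<and>
    norm (bop_apply (?Q (M k n)) (bop_apply (T k) (e n))) \<le> \<epsilon> / 4"
    by metis
  \<comment> \<open>Each block starts where the preceding one ends.\<close>
  define N where "N = rec_nat 0 M"
  have N_Suc: "N (Suc k) = M k (N k)" for k by (simp add: N_def)
  have mono: "strict_mono N" by (rule strict_mono_Suc_iff[THEN iffD2]) (simp add: N_Suc XM)
  define \<xi> where "\<xi> k = X k (N k)" for k
  have norm_xi: "norm (\<xi> k) \<le> 1" and fix_xi: "bop_apply (?Q (N k)) (\<xi> k) = \<xi> k"
    and kill_Suc: "bop_apply (?Q (N (Suc k))) (\<xi> k) = 0"
    and far: "\<epsilon> / 2 \<le> norm (bop_apply (?Q (N k)) (bop_apply (T k) (\<xi> k)) - c k (N k) *\<^sub>C \<xi> k)"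
    and tail: "norm (bop_apply (?Q (N (Suc k))) (bop_apply (T k) (e (N k)))) \<le> \<epsilon> / 4" for k
    using XM[where k = k and n = "N k"] by (simp_all add: \<xi>_def N_Suc)
  have kill: "bop_apply (?Q (N l)) (\<xi> k) = 0" if "k < l" for k l
  proof -
    have "N (Suc k) \<le> N l" using mono that by (simp add: strict_mono_less_eq)
    then have "bop_apply (?Q (N l)) (\<xi> k) = bop_apply (?Q (N l)) (bop_apply (?Q (N (Suc k))) (\<xi> k))"
      by (simp add: tail_projection_mult flip: bop_apply_mult)
    then show ?thesis by (simp add: kill_Suc)
  qed
  have xi_orth: "cinner (\<xi> k) (\<xi> l) = 0" if "k \<noteq> l" for k l
  proof (cases "k < l")
    case True
    then show ?thesis using tail_projection_orthogonal[OF kill fix_xi] by blast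
  next
    case False
    with that have "cinner (\<xi> l) (\<xi> k) = 0"
      using tail_projection_orthogonal[OF kill fix_xi] by simp
    then show ?thesis using cinner_commute[of "\<xi> k" "\<xi> l"] by simp
  qed
  have "orthogonal_contraction \<xi>"
    using norm_xi xi_orth by (simp add: orthogonal_contraction_def)
  then obtain a :: "'h bop" where a: "norm a \<le> 1" "\<And>k. bop_apply a (e (N k)) = \<xi> k"
      "\<And>i. i \<notin> range N \<Longrightarrow> bop_apply a (e i) = 0"
    using exists_bop_on_subsequence[OF strict_mono_imp_inj_on[OF mono]] by blast
  have "\<epsilon> / 4 \<le> norm (a * T k - T k * a)" for k
  proof -
    define n where "n = N k"
    define m where "m = N (Suc k)"
    define y where "y = bop_apply (T k) (e n)"
    \<comment> \<open>Earlier blocks end before \<open>n\<close> and later ones start at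
      \<open>m\<close> or beyond, so only \<open>e n\<close> contributes.\<close>
    have Qa: "bop_apply (?Q n) (bop_apply a (e i)) = (if i = n then \<xi> k else 0)" if "i < m" for i
    proof (cases "i \<in> range N")
      case True
      then obtain l where l: "i = N l" by blast
      with that have "l < Suc k" using mono by (simp add: m_def strict_mono_less)
      then consider "l = k" | "l < k" by linarith
      then show ?thesis
      proof cases
        case 1
        then show ?thesis using l fix_xi by (simp add: a(2) n_def)
      next
        case 2
        then have "i \<noteq> n" using l mono by (simp add: n_def strict_mono_eq)
        then show ?thesis using l kill[OF 2] by (simp add: a(2) n_def)
      qed
    next
      case False
      then show ?thesis by (auto simp: a(3) n_def)
    qed
    have "n < m" using mono by (simp add: n_def m_def strict_mono_less)
    have "bop_apply (?Q n) (bop_apply a (partial_expansion m y))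
        = (\<Sum>i<m. cinner y (e i) *\<^sub>C bop_apply (?Q n) (bop_apply a (e i)))"
      unfolding partial_expansion_def by (simp add: bop_sum bop_apply_scaleC_right)
    also have "\<dots> = (\<Sum>i<m. if i = n then cinner y (e n) *\<^sub>C \<xi> k else 0)"
      by (intro sum.cong) (auto simp: Qa)
    also have "\<dots> = c k n *\<^sub>C \<xi> k" using \<open>n < m\<close> by (simp add: sum.delta c_def y_def)
    finally have head: "bop_apply (?Q n) (bop_apply a (partial_expansion m y)) = c k n *\<^sub>C \<xi> k" .
    define z where "z = bop_apply (?Q n) (bop_apply a (bop_apply (?Q m) y))"
    have "norm z \<le> norm (bop_apply a (bop_apply (?Q m) y))"
      unfolding z_def by (rule norm_tail_projection_apply)
    also have "\<dots> \<le> norm a * norm (bop_apply (?Q m) y)" by (rule norm_bop_apply)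
    also have "\<dots> \<le> norm (bop_apply (?Q m) y)" using a(1) by (simp add: mult_left_le_one_le)
    also have "\<dots> \<le> \<epsilon> / 4" using tail[of k] by (simp add: m_def n_def y_def)
    finally have z: "norm z \<le> \<epsilon> / 4" .
    have "y = partial_expansion m y + bop_apply (?Q m) y" by (simp add: tail_projection_apply)
    then have "bop_apply (?Q n) (bop_apply a y) = c k n *\<^sub>C \<xi> k + z"
      unfolding z_def head[symmetric] by (metis bop_add_right)
    then have eq: "bop_apply (?Q n) (bop_apply (a * T k - T k * a) (e n))
        = z - (bop_apply (?Q n) (bop_apply (T k) (\<xi> k)) - c k n *\<^sub>C \<xi> k)"
      by (simp add: bop_apply_diff bop_apply_mult bop_diff_right a(2) n_def flip: y_def[unfolded n_def])
    have "\<epsilon> / 4 \<le> norm (bop_apply (?Q n) (bop_apply (T k) (\<xi> k)) - c k n *\<^sub>C \<xi> k) - norm z"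
      using far[of k] z by (simp add: n_def)
    also have "\<dots> \<le> norm (bop_apply (?Q n) (bop_apply (a * T k - T k * a) (e n)))"
      unfolding eq by (metis norm_minus_commute norm_triangle_ineq2)
    also have "\<dots> \<le> norm (bop_apply (a * T k - T k * a) (e n))" by (rule norm_tail_projection_apply)
    also have "\<dots> \<le> norm (a * T k - T k * a) * norm (e n)" by (rule norm_bop_apply)
    finally show ?thesis by simp
  qed
  then show ?thesis by blast
qed

section \<open>Shift isometries and comparison of corners\<close>

text \<open>The left inverse is the backward shift: it undoes \<open>\<sigma>\<close> on its range
  and kills the other basis vectors, hence is again a contraction.\<close>

lemma exists_shift:
  assumes "inj \<sigma>"
  shows "\<exists>a a' :: 'h bop. norm a \<le> 1 \<and> norm a' \<le> 1 \<and> a' * a = 1 \<and>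
    (\<forall>i. bop_apply a (e i) = e (\<sigma> i))"
proof -
  have on: "orthogonal_contraction e"
    by (simp add: orthogonal_contraction_def orthonormal)
  have "orthogonal_contraction (\<lambda>i. e (\<sigma> i))"
    using assms by (simp add: orthogonal_contraction_def orthonormal inj_eq)
  then obtain a :: "'h bop" where a: "norm a \<le> 1" "\<forall>i. bop_apply a (e i) = e (\<sigma> i)"
    using exists_bop_on_basis by blast
  obtain a' :: "'h bop" where a': "norm a' \<le> 1" "\<forall>k. bop_apply a' (e (\<sigma> k)) = e k"
    using exists_bop_on_subsequence[OF assms on] by blast
  have "a' * a = 1"
    by (intro bop_eq_on_basisI) (simp add: bop_apply_mult a a')
  with a a' show ?thesis by blast
qed

text \<open>If the isometry \<open>a\<close> maps the range of \<open>Q\<^sub>p\<close> into that of \<open>Q\<^sub>q\<close>, then \<open>ac\<close> retains the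
  \<open>p\<close>-corner of \<open>c\<close> whereas \<open>ca\<close> only sees the \<open>q\<close>-corner of \<open>c\<close>.\<close>

lemma corner_le_commutator:
  fixes a a' c :: "'h bop"
  assumes "norm a \<le> 1" "norm a' \<le> 1" "a' * a = 1"
    and a: "\<And>i. bop_apply a (e i) = e (\<sigma> i)" and \<sigma>: "\<And>i. p \<le> i \<Longrightarrow> q \<le> \<sigma> i"
  shows "norm (tail_projection p * c * tail_projection p)
    \<le> norm (a * c - c * a) + norm (tail_projection q * c * tail_projection q)"
proof -
  let ?P = "tail_projection p" and ?Q = "tail_projection q"
  have a'_basis: "bop_apply a' (e (\<sigma> i)) = e i" for i
    using arg_cong[OF assms(3), of "\<lambda>T. bop_apply T (e i)"] by (simp add: bop_apply_mult a)
  have A: "?P * a' * ?Q * a = ?P"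
    by (rule bop_eq_on_basisI) (use \<sigma> in \<open>auto simp: bop_apply_mult tail_projection_basis a a'_basis not_le leD\<close>)
  have B: "?Q * a * ?P = a * ?P"
    by (rule bop_eq_on_basisI) (use \<sigma> in \<open>auto simp: bop_apply_mult tail_projection_basis a leD not_less\<close>)
  \<comment> \<open>Multiplying the commutator by contractions turns its first term into the
    \<open>p\<close>-corner by \<open>A\<close>; by \<open>B\<close> the second becomes the
    \<open>q\<close>-corner between contractions.\<close>
  have "(?P * a' * ?Q) * (a * c - c * a) * ?P
      = (?P * a' * ?Q * a) * c * ?P - ?P * a' * ?Q * c * (a * ?P)"
    by (simp add: algebra_simps)
  also have "?P * a' * ?Q * c * (a * ?P) = (?P * a') * (?Q * c * ?Q) * (a * ?P)"
    by (subst B[symmetric]) (simp add: mult.assoc)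
  finally have eq: "?P * c * ?P = (?P * a' * ?Q) * (a * c - c * a) * ?P
      + (?P * a') * (?Q * c * ?Q) * (a * ?P)" unfolding A by simp
  have prod: "norm (S * T) \<le> 1" if "norm S \<le> 1" "norm T \<le> 1" for S T :: "'h bop"
    using norm_mult_ineq[of S T] mult_mono[OF that] by simp
  show ?thesis
    unfolding eq
    by (intro norm_triangle_mono norm_mult3_le prod norm_tail_projection assms)
qed

end

section \<open>Sequences that asymptotically commute with all operators\<close>

lemma ultrafilter_not_eventually:
  assumes "ultrafilter \<alpha>" and "\<not> (\<forall>\<^sub>F n in \<alpha>. P n)"
  shows "\<forall>\<^sub>F n in \<alpha>. \<not> P n"
proof -
  have "(\<forall>\<^sub>F n in \<alpha>. n \<in> Collect P) \<or> (\<forall>\<^sub>F n in \<alpha>. n \<in> - Collect P)"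
    using assms(1) unfolding ultrafilter_def by blast
  with assms(2) show ?thesis by simp
qed

lemma pigeonhole_three:
  assumes "\<And>i::nat. P i \<or> Q i \<or> R i"
  shows "\<exists>i k. i < k \<and> (P i \<and> P k \<or> Q i \<and> Q k \<or> R i \<and> R k)"
proof -
  have "(0::nat) < 1" "(0::nat) < 2" "(0::nat) < 3" "(1::nat) < 2" "(1::nat) < 3" "(2::nat) < 3"
    by simp_all
  then show ?thesis using assms[of 0] assms[of 1] assms[of 2] assms[of 3] by blast
qed

text \<open>Among any four functions two have the same of the three types, and two functions of the
  same type are comparable modulo the ultrafilter.\<close>

lemma three_functions_dominated:
  fixes f :: "nat \<Rightarrow> nat \<Rightarrow> nat"
  assumes "three_functions_property \<alpha>"
  shows "\<exists>i k J. i < k \<and> (\<forall>\<^sub>F n in \<alpha>. f k n \<le> J (f i n))"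
proof -
  obtain \<phi> :: "nat \<Rightarrow> nat \<times> nat" where \<phi>: "\<And>f :: nat \<Rightarrow> nat. \<exists>A. (\<forall>\<^sub>F n in \<alpha>. n \<in> A) \<and>
      (f constant_on A \<or> finite_to_one_on f A \<or> (\<exists>g. inj g \<and> (\<forall>n\<in>A. f n = (g \<circ> fst \<circ> \<phi>) n)))"
    using assms unfolding three_functions_property_def by blast
  define C where "C (i::nat) \<longleftrightarrow> (\<exists>A. (\<forall>\<^sub>F n in \<alpha>. n \<in> A) \<and> f i constant_on A)" for i
  define F where "F (i::nat) \<longleftrightarrow> (\<exists>A. (\<forall>\<^sub>F n in \<alpha>. n \<in> A) \<and> finite_to_one_on (f i) A)" for i
  define G where "G (i::nat) \<longleftrightarrow> (\<exists>A g. (\<forall>\<^sub>F n in \<alpha>. n \<in> A) \<and> inj g \<and> (\<forall>n\<in>A. f i n = g (fst (\<phi> n))))" for i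
  have "C i \<or> F i \<or> G i" for i
    using \<phi>[of "f i"] unfolding C_def F_def G_def comp_def by metis
  then obtain i k where ik: "i < k" "C i \<and> C k \<or> F i \<and> F k \<or> G i \<and> G k"
    using pigeonhole_three[of C F G] by blast
  \<comment> \<open>It suffices that \<open>f k\<close> takes finitely many values on each fibre of
    \<open>f i\<close>: their maximum defines \<open>J\<close>.\<close>
  obtain B where B: "\<forall>\<^sub>F n in \<alpha>. n \<in> B" "\<And>s. finite (f k ` {n \<in> B. f i n = s})"
  proof -
    consider "C k" | "F i" | "G i" "G k" using ik(2) by blast
    then show ?thesis
    proof cases
      case 1
      then obtain A where A: "\<forall>\<^sub>F n in \<alpha>. n \<in> A" "f k constant_on A" unfolding C_def by blast
      then obtain y where "\<And>n. n \<in> A \<Longrightarrow> f k n = y" unfolding constant_on_def by blast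
      then have "f k ` {n \<in> A. f i n = s} \<subseteq> {y}" for s by auto
      then show ?thesis using that[OF A(1)] finite_subset by blast
    next
      case 2
      then show ?thesis using that unfolding F_def finite_to_one_on_def by blast
    next
      case 3
      then obtain A g A' g' where A: "\<forall>\<^sub>F n in \<alpha>. n \<in> A" "\<forall>\<^sub>F n in \<alpha>. n \<in> A'"
        and g: "inj g" "\<And>n. n \<in> A \<Longrightarrow> f i n = g (fst (\<phi> n))"
        and g': "\<And>n. n \<in> A' \<Longrightarrow> f k n = g' (fst (\<phi> n))"
        unfolding G_def by metis
      \<comment> \<open>As \<open>g\<close> is injective, the value of \<open>f i\<close> determines
        the first coordinate of \<open>\<phi> n\<close> and thereby the value of
        \<open>f k\<close>.\<close>
      have "f k ` {n \<in> A \<inter> A'. f i n = s} \<subseteq> g' ` (g -` {s})" for s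
        using g(2) g' by auto
      moreover have "finite (g -` {s})" for s using g(1) by (simp add: finite_vimageI)
      ultimately have "finite (f k ` {n \<in> A \<inter> A'. f i n = s})" for s
        by (meson finite_imageI finite_subset)
      moreover have "\<forall>\<^sub>F n in \<alpha>. n \<in> A \<inter> A'" using A by eventually_elim simp
      ultimately show ?thesis using that by blast
    qed
  qed
  have "f k n \<le> Max (f k ` {m \<in> B. f i m = f i n})" if "n \<in> B" for n
    using B(2) that by (intro Max_ge) auto
  then have "\<forall>\<^sub>F n in \<alpha>. f k n \<le> Max (f k ` {m \<in> B. f i m = f i n})"
    using B(1) by (auto elim: eventually_mono)
  with ik(1) show ?thesis
    by (intro exI[of _ i] exI[of _ k] exI[of _ "\<lambda>s. Max (f k ` {m \<in> B. f i m = s})"]) simp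
qed

section \<open>Approximation by scalars, first modulo compact operators, then in norm\<close>

context hilbert_basis
begin

text \<open>The vector \<open>e j\<close> attains the norm. Thus the corner of
  \<open>c *\<^sub>C 1\<close> has norm \<open>cmod c\<close> at every cutoff, which makes corners
  for different scalars comparable.\<close>

lemma norm_tail_projection_square: "norm (tail_projection j * tail_projection j) = 1"
proof (rule antisym)
  have "norm (bop_apply (tail_projection j * tail_projection j) (e j))
      \<le> norm (tail_projection j * tail_projection j) * norm (e j)"
    by (rule norm_bop_apply)
  then show "1 \<le> norm (tail_projection j * tail_projection j)"
    by (simp add: bop_apply_mult tail_projection_basis)
qed (simp add: tail_projection_mult norm_tail_projection)

text \<open>Otherwise \<open>exists_commutators_bounded_below\<close> yields one operator whose
  commutators with the far \<open>x n\<close> have norm at least \<delta>/4.\<close>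

lemma asymptotically_commuting_near_scalar:
  fixes x :: "nat \<Rightarrow> 'h bop"
  assumes "ultrafilter \<alpha>" and comm: "\<And>a. ((\<lambda>n. norm (a * x n - x n * a)) \<longlongrightarrow> 0) \<alpha>"
    and "0 < \<delta>"
  shows "\<not> (\<forall>\<^sub>F n in \<alpha>. \<forall>c j. \<delta> \<le> norm (tail_projection j * (x n - c *\<^sub>C 1) * tail_projection j))"
proof
  let ?far = "\<lambda>T :: 'h bop. \<forall>c j. \<delta> \<le> norm (tail_projection j * (T - c *\<^sub>C 1) * tail_projection j)"
  assume far: "\<forall>\<^sub>F n in \<alpha>. ?far (x n)"
  have nb: "\<alpha> \<noteq> bot" using assms(1) by (simp add: ultrafilter_def)
  obtain n0 where n0: "?far (x n0)" using eventually_happens'[OF nb far] by blast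
  \<comment> \<open>The construction of \<open>a\<close> wants every term to be far from scalars, so
    the exceptional indices receive the default \<open>x n0\<close>.\<close>
  define T where "T n = (if ?far (x n) then x n else x n0)" for n
  have "?far (T n)" for n using n0 by (simp add: T_def)
  then obtain a where a: "\<And>n. \<delta> / 4 \<le> norm (a * T n - T n * a)"
    using exists_commutators_bounded_below[of \<delta> T] assms(3) by blast
  have "\<forall>\<^sub>F n in \<alpha>. norm (a * x n - x n * a) < \<delta> / 4"
    using order_tendstoD(2)[OF comm, of "\<delta> / 4"] assms(3) by simp
  with far have "\<forall>\<^sub>F n in \<alpha>. False"
  proof eventually_elim
    case (elim n)
    then have "T n = x n" by (simp add: T_def)
    with a[of n] elim(2) show ?case by simp
  qed
  with nb show False by simp
qed

text \<open>If every scalar failed with a margin of its own, compactness would give a uniform margin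
  on a disc, while scalars outside it fail because the \<open>x n\<close> are bounded. A uniform
  margin contradicts the preceding lemma.\<close>

lemma asymptotically_commuting_scalar_modulo_compacts:
  fixes x :: "nat \<Rightarrow> 'h bop"
  assumes "ultrafilter \<alpha>" and comm: "\<And>a. ((\<lambda>n. norm (a * x n - x n * a)) \<longlongrightarrow> 0) \<alpha>"
    and "Bseq x"
  shows "\<exists>c. \<forall>\<delta>>0. \<forall>\<^sub>F n in \<alpha>. \<exists>j. norm (tail_projection j * (x n - c *\<^sub>C 1) * tail_projection j) < \<delta>"
proof (rule ccontr)
  let ?Q = tail_projection
  define \<mu> where "\<mu> n c j = norm (?Q j * (x n - c *\<^sub>C 1) * ?Q j)" for n c j
  obtain K where K: "\<And>n. norm (x n) \<le> K" using assms(3) unfolding Bseq_def by blast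
  assume "\<not> ?thesis"
  then have "\<forall>c. \<exists>\<delta>>0. \<not> (\<forall>\<^sub>F n in \<alpha>. \<exists>j. \<mu> n c j < \<delta>)" by (auto simp: \<mu>_def)
  then obtain d where d: "\<And>c. 0 < d c" "\<And>c. \<not> (\<forall>\<^sub>F n in \<alpha>. \<exists>j. \<mu> n c j < d c)" by metis
  have ev: "\<forall>\<^sub>F n in \<alpha>. \<forall>j. d c \<le> \<mu> n c j" for c
    using ultrafilter_not_eventually[OF assms(1) d(2)] by (simp add: not_less)
  \<comment> \<open>Half of the margin is spent on moving from the centre of a ball to its other
    points.\<close>
  obtain D where D: "finite D" "cball 0 (K + 1) \<subseteq> (\<Union>c\<in>D. ball c (d c / 2))"
  proof (rule compactE_image[of "cball (0::complex) (K + 1)" UNIV "\<lambda>c. ball c (d c / 2)"])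
    show "cball 0 (K + 1) \<subseteq> (\<Union>c. ball c (d c / 2))"
    proof
      show "c \<in> (\<Union>c. ball c (d c / 2))" for c
        using d(1)[of c] by (intro UN_I[of c]) simp_all
    qed
  qed auto
  \<comment> \<open>The entry 1 is the margin for scalars outside the disc of radius
    \<open>K + 1\<close>.\<close>
  define \<delta> where "\<delta> = Min (insert 1 ((\<lambda>c. d c / 2) ` D))"
  have "0 < \<delta>" unfolding \<delta>_def using D(1) d(1) by (subst Min_gr_iff) auto
  have \<delta>: "\<delta> \<le> 1" "\<And>c. c \<in> D \<Longrightarrow> \<delta> \<le> d c / 2"
    unfolding \<delta>_def using D(1) by (intro Min_le; simp)+
  have shift: "\<bar>\<mu> n c j - \<mu> n c' j\<bar> \<le> cmod (c - c')" for n c c' j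
  proof -
    have "?Q j * (x n - c *\<^sub>C 1) * ?Q j - ?Q j * (x n - c' *\<^sub>C 1) * ?Q j = (c' - c) *\<^sub>C (?Q j * ?Q j)"
      by (simp add: algebra_simps scaleC_mult_left scaleC_mult_right)
    then have "norm (?Q j * (x n - c *\<^sub>C 1) * ?Q j - ?Q j * (x n - c' *\<^sub>C 1) * ?Q j) = cmod (c' - c)"
      by (simp add: norm_scaleC norm_tail_projection_square)
    then show ?thesis
      unfolding \<mu>_def using norm_triangle_ineq3 by (metis norm_minus_commute)
  qed
  have large: "cmod c - K \<le> \<mu> n c j" for n c j
  proof -
    have "c *\<^sub>C (?Q j * ?Q j) = ?Q j * x n * ?Q j - ?Q j * (x n - c *\<^sub>C 1) * ?Q j"
      by (simp add: algebra_simps scaleC_mult_left scaleC_mult_right)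
    from arg_cong[OF this, of norm]
    have "cmod c \<le> norm (?Q j * x n * ?Q j) + \<mu> n c j"
      unfolding \<mu>_def norm_scaleC norm_tail_projection_square using norm_triangle_ineq4 by simp
    moreover have "norm (?Q j * x n * ?Q j) \<le> norm (x n)"
      by (intro norm_mult3_le norm_tail_projection)
    ultimately show ?thesis using K[of n] by linarith
  qed
  have "\<forall>\<^sub>F n in \<alpha>. \<forall>c\<in>D. \<forall>j. d c \<le> \<mu> n c j"
    using D(1) ev by (intro eventually_ball_finite) auto
  then have "\<forall>\<^sub>F n in \<alpha>. \<forall>c j. \<delta> \<le> \<mu> n c j"
  proof eventually_elim
    case (elim n)
    show ?case
    proof (intro allI)
      fix c j
      show "\<delta> \<le> \<mu> n c j"
      proof (cases "c \<in> cball 0 (K + 1)")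
        case True
        then obtain c' where c': "c' \<in> D" "c \<in> ball c' (d c' / 2)" using D(2) by blast
        then have "cmod (c' - c) < d c' / 2" by (simp add: dist_norm)
        moreover have "d c' \<le> \<mu> n c' j" using elim c'(1) by blast
        ultimately show ?thesis using shift[of n c' j c] \<delta>(2)[OF c'(1)] by linarith
      next
        case False
        then show ?thesis using large[of c n j] \<delta>(1) by simp
      qed
    qed
  qed
  then show False
    using asymptotically_commuting_near_scalar[OF assms(1) comm \<open>0 < \<delta>\<close>] by (simp add: \<mu>_def)
qed

text \<open>A failure is detected by a single shift: \<open>f i\<close> and \<open>f k\<close> mark
  where the corner norms drop below two thresholds at least a factor 2 apart.\<close>

lemma asymptotically_commuting_vanishing:
  fixes y :: "nat \<Rightarrow> 'h bop"
  assumes "ultrafilter \<alpha>" and "three_functions_property \<alpha>"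
    and comm: "\<And>a. ((\<lambda>n. norm (a * y n - y n * a)) \<longlongrightarrow> 0) \<alpha>"
    and small: "\<And>\<delta>. 0 < \<delta> \<Longrightarrow> \<forall>\<^sub>F n in \<alpha>. \<exists>j. norm (tail_projection j * y n * tail_projection j) < \<delta>"
  shows "((\<lambda>n. norm (y n)) \<longlongrightarrow> 0) \<alpha>"
proof (rule ccontr)
  assume "\<not> ?thesis"
  then obtain \<epsilon> where "0 < \<epsilon>" "\<not> (\<forall>\<^sub>F n in \<alpha>. norm (y n) < \<epsilon>)"
    unfolding tendsto_iff by (auto simp: dist_real_def)
  then have big: "\<forall>\<^sub>F n in \<alpha>. \<epsilon> \<le> norm (y n)"
    using ultrafilter_not_eventually[OF assms(1), of "\<lambda>n. norm (y n) < \<epsilon>"]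
    by (simp add: not_less)
  define \<mu> where "\<mu> n j = norm (tail_projection j * y n * tail_projection j)" for n j
  define d where "d i = \<epsilon> / 2 ^ i" for i :: nat
  have d_pos: "0 < d i" and d_le: "d i \<le> \<epsilon>" for i
    using \<open>0 < \<epsilon>\<close> by (simp_all add: d_def field_simps)
  define f where "f i n = (LEAST j. \<mu> n j < d i)" for i n
  obtain i k J where ik: "i < k" and J: "\<forall>\<^sub>F n in \<alpha>. f k n \<le> J (f i n)"
    using three_functions_dominated[OF assms(2), of f] by blast
  have "d k \<le> d (Suc i)"
    unfolding d_def using ik \<open>0 < \<epsilon>\<close> by (intro divide_left_mono power_increasing) auto
  then have d_half: "d k \<le> d i / 2" by (simp add: d_def)
  \<comment> \<open>The sum makes \<open>\<sigma>\<close> strictly increasing and at least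
    \<open>J s\<close> for every \<open>s \<le> Suc r\<close>; the successor accounts for the corner
    being taken at \<open>f i n - 1\<close>.\<close>
  define \<sigma> where "\<sigma> r = r + (\<Sum>s\<le>Suc r. J s)" for r
  have "strict_mono \<sigma>" by (rule strict_mono_Suc_iff[THEN iffD2]) (simp add: \<sigma>_def)
  then obtain a a' :: "'h bop" where a: "norm a \<le> 1" "norm a' \<le> 1" "a' * a = 1"
      "\<And>r. bop_apply a (e r) = e (\<sigma> r)"
    using exists_shift[OF strict_mono_imp_inj_on] by blast
  have "\<forall>\<^sub>F n in \<alpha>. norm (a * y n - y n * a) < d i / 2"
    using order_tendstoD(2)[OF comm, of "d i / 2"] d_pos[of i] by simp
  with big J small[OF d_pos[of i]] small[OF d_pos[of k]] have "\<forall>\<^sub>F n in \<alpha>. False"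
  proof eventually_elim
    case (elim n)
    have fi: "\<mu> n (f i n) < d i" and fk: "\<mu> n (f k n) < d k"
      using elim(3,4) unfolding f_def \<mu>_def by (auto intro: LeastI_ex)
    \<comment> \<open>At cutoff 0 the corner is \<open>y n\<close> itself, of norm at least
      \<open>d i\<close>. So \<open>f i n - 1\<close> is a smaller cutoff, and minimality bounds its
      corner from below.\<close>
    have "f i n \<noteq> 0"
    proof
      assume "f i n = 0"
      with fi d_le[of i] elim(1) show False by (simp add: \<mu>_def)
    qed
    then have "d i \<le> \<mu> n (f i n - 1)"
      using not_less_Least[of "f i n - 1" "\<lambda>j. \<mu> n j < d i"] by (simp add: not_less f_def)
    also have "\<dots> \<le> norm (a * y n - y n * a) + \<mu> n (f k n)"
      unfolding \<mu>_def
    proof (rule corner_le_commutator[OF a])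
      fix r assume "f i n - 1 \<le> r"
      then have "J (f i n) \<le> (\<Sum>s\<le>Suc r. J s)" by (intro member_le_sum) auto
      with elim(2) show "f k n \<le> \<sigma> r" by (simp add: \<sigma>_def)
    qed
    also have "\<dots> < d i" using elim(5) fk d_half by linarith
    finally show ?case by simp
  qed
  with assms(1) show False by (simp add: ultrafilter_def)
qed

text \<open>Subtracting a scalar changes no commutator, so the two preceding lemmas combine.\<close>

lemma asymptotically_commuting_scalar:
  fixes x :: "nat \<Rightarrow> 'h bop"
  assumes "ultrafilter \<alpha>" and "three_functions_property \<alpha>" and "Bseq x"
    and comm: "\<And>a. ((\<lambda>n. norm (a * x n - x n * a)) \<longlongrightarrow> 0) \<alpha>"
  shows "\<exists>c. ((\<lambda>n. norm (x n - c *\<^sub>C 1)) \<longlongrightarrow> 0) \<alpha>"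
proof -
  obtain c where c: "\<And>\<delta>. 0 < \<delta> \<Longrightarrow>
      \<forall>\<^sub>F n in \<alpha>. \<exists>j. norm (tail_projection j * (x n - c *\<^sub>C 1) * tail_projection j) < \<delta>"
    using asymptotically_commuting_scalar_modulo_compacts[OF assms(1) comm assms(3)] by blast
  have "a * (x n - c *\<^sub>C 1) - (x n - c *\<^sub>C 1) * a = a * x n - x n * a" for a n
    by (simp add: algebra_simps scaleC_mult_left scaleC_mult_right)
  then show ?thesis
    using asymptotically_commuting_vanishing[OF assms(1,2), of "\<lambda>n. x n - c *\<^sub>C 1"] comm c by auto
qed

end

section \<open>The ultrapower\<close>

text \<open>Cosets agree when the difference lies in the ideal; its boundedness is
  automatic.\<close>

lemma bounded_sequences_coset_eq_iff:
  fixes x y :: "nat \<Rightarrow> 'a::complex_unital_normed_algebra"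
  assumes "Bseq x" "Bseq y"
  shows "null_sequences \<alpha> +>\<^bsub>bounded_sequences\<^esub> x = null_sequences \<alpha> +>\<^bsub>bounded_sequences\<^esub> y
    \<longleftrightarrow> ((\<lambda>n. norm (x n - y n)) \<longlongrightarrow> 0) \<alpha>"
proof -
  let ?R = "bounded_sequences :: (nat \<Rightarrow> 'a) ring"
  interpret ideal "null_sequences \<alpha>" ?R by (rule ideal_null_sequences)
  have xy: "x \<in> carrier ?R" "y \<in> carrier ?R" using assms by (simp_all add: bounded_sequences_def)
  have my: "(\<lambda>n. - y n) \<in> carrier ?R" using assms by (simp add: bounded_sequences_def Bseq_minus_iff)
  then have "\<ominus>\<^bsub>?R\<^esub> y = (\<lambda>n. - y n)"
    using xy by (intro minus_equality) (simp_all add: bounded_sequences_def)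
  then have "x \<ominus>\<^bsub>?R\<^esub> y = (\<lambda>n. x n - y n)"
    by (simp add: a_minus_def) (simp add: bounded_sequences_def)
  moreover have "Bseq (\<lambda>n. x n - y n)"
    using Bseq_add_seq[of x "\<lambda>n. - y n"] assms by (simp add: Bseq_minus_iff)
  ultimately show ?thesis
    using quotient_eq_iff_same_a_r_cos[OF ideal_axioms xy] by (simp add: null_sequences_def)
qed

lemma ultrapower_mult_coset:
  assumes "Bseq x" "Bseq y"
  shows "(null_sequences \<alpha> +>\<^bsub>bounded_sequences\<^esub> x) \<otimes>\<^bsub>ultrapower \<alpha>\<^esub> (null_sequences \<alpha> +>\<^bsub>bounded_sequences\<^esub> y)
    = null_sequences \<alpha> +>\<^bsub>bounded_sequences\<^esub> (\<lambda>n. x n * y n)"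
  using ideal.rcoset_mult_add[OF ideal_null_sequences, of x y \<alpha>] assms
  by (simp add: ultrapower_def FactRing_def bounded_sequences_def)

text \<open>Products of cosets are computed termwise, so commuting with constants becomes a
  statement about a bounded representative.\<close>

lemma ultrapower_commutant_iff:
  fixes b :: "(nat \<Rightarrow> 'a::complex_unital_normed_algebra) set"
  shows
  "b \<in> ultrapower_commutant \<alpha> \<longleftrightarrow>
    (\<exists>x. Bseq x \<and> b = null_sequences \<alpha> +>\<^bsub>bounded_sequences\<^esub> x \<and>
      (\<forall>a. ((\<lambda>n. norm (a * x n - x n * a)) \<longlongrightarrow> 0) \<alpha>))"
proof -
  have carrier: "b \<in> carrier (ultrapower \<alpha>) \<longleftrightarrow>
      (\<exists>x. Bseq x \<and> b = null_sequences \<alpha> +>\<^bsub>bounded_sequences\<^esub> x)"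
  proof -
    have "carrier (ultrapower \<alpha>) = (\<lambda>x. null_sequences \<alpha> +>\<^bsub>bounded_sequences\<^esub> x) `
        carrier (bounded_sequences :: (nat \<Rightarrow> 'a) ring)"
      by (auto simp: ultrapower_def FactRing_def A_RCOSETS_def RCOSETS_def a_r_coset_def)
    then show ?thesis by (auto simp: bounded_sequences_def)
  qed
  have commute: "(null_sequences \<alpha> +>\<^bsub>bounded_sequences\<^esub> x) \<otimes>\<^bsub>ultrapower \<alpha>\<^esub> const_class \<alpha> a
      = const_class \<alpha> a \<otimes>\<^bsub>ultrapower \<alpha>\<^esub> (null_sequences \<alpha> +>\<^bsub>bounded_sequences\<^esub> x)
    \<longleftrightarrow> ((\<lambda>n. norm (a * x n - x n * a)) \<longlongrightarrow> 0) \<alpha>" if "Bseq x" for x a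
    using that
    by (simp add: const_class_def ultrapower_mult_coset bounded_sequences_coset_eq_iff Bseq_mult_seq
        norm_minus_commute)
  have "b \<in> ultrapower_commutant \<alpha> \<longleftrightarrow>
      (\<exists>x. Bseq x \<and> b = null_sequences \<alpha> +>\<^bsub>bounded_sequences\<^esub> x \<and>
        (\<forall>a. b \<otimes>\<^bsub>ultrapower \<alpha>\<^esub> const_class \<alpha> a = const_class \<alpha> a \<otimes>\<^bsub>ultrapower \<alpha>\<^esub> b))"
    unfolding ultrapower_commutant_def mem_Collect_eq carrier by blast
  then show ?thesis by (simp add: commute cong: conj_cong)
qed

theorem theorem26:
  fixes \<alpha> :: "nat filter"
  assumes "separable_space (euclidean :: 'h::complex_hilbert topology)"
    and "infinite_dimensional TYPE('h)"
    and "nonprincipal_ultrafilter \<alpha>"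
    and "three_functions_property \<alpha>"
  shows "ultrapower_commutant \<alpha> = (ultrapower_scalars \<alpha> :: (nat \<Rightarrow> 'h bop) set set)"
proof (rule subset_antisym; rule subsetI)
  obtain e :: "nat \<Rightarrow> 'h" where "hilbert_basis e" using exists_hilbert_basis assms(1,2) by blast
  then interpret hilbert_basis e .
  have "ultrafilter \<alpha>" using assms(3) by (simp add: nonprincipal_ultrafilter_def)
  fix b :: "(nat \<Rightarrow> 'h bop) set"
  assume "b \<in> ultrapower_commutant \<alpha>"
  then obtain x where x: "Bseq x" "b = null_sequences \<alpha> +>\<^bsub>bounded_sequences\<^esub> x"
      "\<And>a. ((\<lambda>n. norm (a * x n - x n * a)) \<longlongrightarrow> 0) \<alpha>"
    unfolding ultrapower_commutant_iff by blast
  then obtain c where "((\<lambda>n. norm (x n - c *\<^sub>C 1)) \<longlongrightarrow> 0) \<alpha>"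
    using asymptotically_commuting_scalar[OF \<open>ultrafilter \<alpha>\<close> assms(4)] by blast
  then have "b = const_class \<alpha> (c *\<^sub>C 1)"
    using x by (simp add: const_class_def bounded_sequences_coset_eq_iff)
  then show "b \<in> ultrapower_scalars \<alpha>" by (simp add: ultrapower_scalars_def)
next
  fix b :: "(nat \<Rightarrow> 'h bop) set"
  assume "b \<in> ultrapower_scalars \<alpha>"
  then obtain c where b: "b = const_class \<alpha> (c *\<^sub>C 1)" unfolding ultrapower_scalars_def by blast
  show "b \<in> ultrapower_commutant \<alpha>"
    unfolding ultrapower_commutant_iff
    \<comment> \<open>The constant representative commutes exactly with every operator.\<close>
    by (intro exI[of _ "\<lambda>n. c *\<^sub>C 1"])
      (simp add: b const_class_def scaleC_mult_left scaleC_mult_right)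
qed

end
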